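(* Let $F_\alpha(x)=\dfrac{\Gamma(x+\alpha)}{x^\alpha\,\Gamma(x)}$ for $x>0$. For every $0<\alpha<1$, $F_\alpha$ is a Bernstein function but not a complete Bernstein function. Equivalently, the Lévy measure $\dfrac{1}{\Gamma(\alpha)\Gamma(1-\alpha)}\,\mu_\alpha$ of $F_\alpha$, appearing in the representation $$F_\alpha(x)=\frac{1}{\Gamma(\alpha)\Gamma(1-\alpha)}\int_{(0,\infty)}(1-e^{-xt})\,\mu_\alpha(dt),\qquad x>0,$$ is not absolutely continuous with a completely monotone density.
   Context: A function $f:(0,\infty)\to[0,\infty)$ is completely monotone if $f\in C^\infty$ and $(-1)^n f^{(n)}(x)\ge 0$ for all $n\ge 0$, $x>0$. A function $g:(0,\infty)\to[0,\infty)$ is a Bernstein function if $g\in C^\infty$ and $g'$ is completely monotone; equivalently, with unique $(a,b,\nu)$, $g(x)=a+bx+\int_{(0,\infty)}(1-e^{-xt})\,\nu(dt)$, where $a,b\ge 0$ and $\nu$ is a positive measure on $(0,\infty)$ (the Lévy measure) with $\int(1\wedge t)\,\nu(dt)<\infty$. A Bernstein function is a complete Bernstein function if its Lévy measure is absolutely continuous with a completely monotone density. Here $\mu_\alpha=-dJ_\alpha$ is the finite positive measure on $(0,\infty)$ obtained from the decreasing function $J_\alpha(t)=\int_0^t(t-u)^{\alpha-1}(e^u-1)^{-\alpha}\,du$, $t>0$; that is, $\mu_\alpha((s,t])=J_\alpha(s)-J_\alpha(t)$ for $0<s<t$. *)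

theory Defs
  imports "HOL-Analysis.Analysis"
begin

(* Functions on (0, infinity) are represented by functions real => real whose values outside
   (0, infinity) are irrelevant: since (0, infinity) is open, deriv at x > 0 only sees values there. *)

definition smooth_on_pos :: "(real \<Rightarrow> real) \<Rightarrow> bool" where
  "smooth_on_pos f \<longleftrightarrow> (\<forall>n. \<forall>x>0. ((deriv ^^ n) f) differentiable (at x))"

(* The case n = 0 says that f is nonnegative on (0, infinity). *)
definition completely_monotone :: "(real \<Rightarrow> real) \<Rightarrow> bool" where
  "completely_monotone f \<longleftrightarrow>
     smooth_on_pos f \<and> (\<forall>n. \<forall>x>0. (-1) ^ n * (deriv ^^ n) f x \<ge> 0)"

definition bernstein_function :: "(real \<Rightarrow> real) \<Rightarrow> bool" where
  "bernstein_function g \<longleftrightarrow>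
     (\<forall>x>0. g x \<ge> 0) \<and> smooth_on_pos g \<and> completely_monotone (deriv g)"

(* (a, b, \<nu>) is the Levy triple of g; \<nu> is a Borel measure on the space (0, infinity). *)
definition levy_triple :: "(real \<Rightarrow> real) \<Rightarrow> real \<Rightarrow> real \<Rightarrow> real measure \<Rightarrow> bool" where
  "levy_triple g a b \<nu> \<longleftrightarrow>
     a \<ge> 0 \<and> b \<ge> 0 \<and>
     sets \<nu> = sets (restrict_space borel {0<..}) \<and>
     (\<integral>\<^sup>+t. ennreal (min 1 t) \<partial>\<nu>) < \<infinity> \<and>
     (\<forall>x>0. g x = a + b * x + (LINT t|\<nu>. 1 - exp (- x * t)))"

definition has_cm_density :: "real measure \<Rightarrow> bool" where
  "has_cm_density \<nu> \<longleftrightarrow>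
     (\<exists>m. completely_monotone m \<and>
          \<nu> = density (restrict_space lborel {0<..}) (\<lambda>t. ennreal (m t)))"

(* The Levy triple of a Bernstein function is unique, so that the existential quantifier
   expresses a property of "the" Levy measure. *)
definition complete_bernstein_function :: "(real \<Rightarrow> real) \<Rightarrow> bool" where
  "complete_bernstein_function g \<longleftrightarrow>
     bernstein_function g \<and> (\<exists>a b \<nu>. levy_triple g a b \<nu> \<and> has_cm_density \<nu>)"

definition F_alpha :: "real \<Rightarrow> real \<Rightarrow> real" where
  "F_alpha \<alpha> x = Gamma (x + \<alpha>) / (x powr \<alpha> * Gamma x)"

definition J_alpha :: "real \<Rightarrow> real \<Rightarrow> real" where
  "J_alpha \<alpha> t = (LINT u:{0<..<t}|lborel. (t - u) powr (\<alpha> - 1) * (exp u - 1) powr (- \<alpha>))"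

(* The measure -dJ on (0, infinity). The Stieltjes measure interval_measure needs a right-continuous
   function on all of the reals, so J is extended to (-infinity, 0] by the constant J(0+);
   this does not affect the restriction to (0, infinity). *)
definition mu_alpha :: "real \<Rightarrow> real measure" where
  "mu_alpha \<alpha> = restrict_space
     (interval_measure (\<lambda>t. - (if t > 0 then J_alpha \<alpha> t else Lim (at_right 0) (J_alpha \<alpha>)))) {0<..}"

definition levy_measure_F_alpha :: "real \<Rightarrow> real measure" where
  "levy_measure_F_alpha \<alpha> = scale_measure (ennreal (1 / (Gamma \<alpha> * Gamma (1 - \<alpha>)))) (mu_alpha \<alpha>)"

end

theory Submission
  imports Defs "HOL-Complex_Analysis.Complex_Analysis"
begin

text \<open>
  The Laplace transform turns the convolution J into a product. The factor \<open>t powr (\<alpha> - 1)\<close> has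
  transform \<open>Gamma \<alpha> * x powr - \<alpha>\<close>, and \<open>(exp u - 1) powr - \<alpha>\<close> has, after the substitution
  \<open>w = exp (- u)\<close>, the Beta integral \<open>Gamma (x + \<alpha>) * Gamma (1 - \<alpha>) / Gamma (x + 1)\<close> as transform.
  Hence \<open>Gamma \<alpha> * Gamma (1 - \<alpha>) * F_alpha \<alpha> x / x\<close> is the Laplace transform of J
  (\<open>laplace_transform_J\<close>). The substitution \<open>u = t * s\<close> shows that
  J decreases continuously from a finite limit at 0 to 0 at infinity (\<open>J_alpha_rescaled\<close>), so \<open>- dJ\<close> is a
  finite measure whose tails are the values of J, and Tonelli's theorem turns the Laplace transform of J
  into the Levy representation of F. Differentiating this representation under the integral shows that
  F is a Bernstein function.

  For the negative part, suppose that the Levy measure had a completely monotone density m. Then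
  \<open>J' = - m / c\<close> for a constant \<open>c > 0\<close>, so J itself would be completely monotone. On \<open>[0, 2 * pi)\<close>, however, J is the power
  series with coefficients \<open>(-1) ^ n * r n * Beta (n + 1 - \<alpha>) \<alpha>\<close>, where \<open>r n\<close> are the Taylor coefficients
  of \<open>H x = (x / (1 - exp (- x))) powr \<alpha>\<close> (\<open>J_ext_power_series\<close>). Letting x tend to 0 in the sign
  conditions on the derivatives of J would give \<open>r n \<ge> 0\<close> for all n. A power series with nonnegative
  coefficients is at least as large on the positive axis as anywhere else on the same circle; but the complex function H stays
  bounded on \<open>[0, 2 * pi)\<close> and blows up at \<open>2 * pi * \<i>\<close>, because \<open>1 - exp (- z)\<close> vanishes there. So some
  \<open>r n\<close> is negative (\<open>todd_powr_series_has_negative_coeff\<close>).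

  That F is not complete Bernstein is a statement about every Levy triple of F. Since F is bounded and
  tends to 0 at 0, any such triple has \<open>a = b = 0\<close> and a finite measure, and that measure has the same
  integrals of all powers of \<open>exp (- t)\<close> as the measure found above. By the Weierstrass approximation
  theorem the two measures agree on all intervals \<open>{0<..s}\<close> (\<open>bounded_levy_triple_unique\<close>), and the
  argument of the previous paragraph applies.
\<close>

section \<open>The power series of powers of the Todd function\<close>

text \<open>The factor \<open>(v / (exp v - 1)) powr \<alpha>\<close> occurring in J is the value at
  \<open>- v\<close>. The argument is negated because then nonnegative Taylor coefficients are what
  complete monotonicity of J would require.\<close>

definition todd_powr :: "real \<Rightarrow> real \<Rightarrow> real" where
  "todd_powr \<alpha> x = (if x = 0 then 1 else (x / (1 - exp (- x))) powr \<alpha>)"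

text \<open>The zeros of \<open>1 - exp (- z)\<close> nearest to the origin, apart from the origin
  itself, are \<open>2 * pi * \<i>\<close> and \<open>- 2 * pi * \<i>\<close>. On the disc of radius
  \<open>2 * pi\<close> the quotient \<open>(1 - exp (- z)) / z\<close> therefore has a holomorphic
  logarithm, which defines the power. The norm of the power does not depend on the branch, and this
  formula is what detects the blow-up at \<open>2 * pi * \<i>\<close>.\<close>

lemma todd_powr_holomorphic_extension:
  obtains H where "H holomorphic_on ball 0 (2 * pi)"
    and "\<And>x. \<bar>x\<bar> < 2 * pi \<Longrightarrow> H (complex_of_real x) = of_real (todd_powr \<alpha> x)"
    and "\<And>z. norm z < 2 * pi \<Longrightarrow> z \<noteq> 0 \<Longrightarrow> norm (H z) = norm ((1 - exp (- z)) / z) powr - \<alpha>"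
proof -
  let ?B = "ball (0::complex) (2 * pi)"
  define Q where "Q = (\<lambda>z::complex. if z = 0 then 1 else (1 - exp (- z)) / z)"
  have "deriv (\<lambda>z::complex. - exp (- z)) 0 = 1"
    by (rule DERIV_imp_deriv) (auto intro!: derivative_eq_intros)
  then have "Q = (\<lambda>z. if z = 0 then deriv (\<lambda>z. - exp (- z)) 0
      else ((\<lambda>z. - exp (- z)) z - (\<lambda>z. - exp (- z)) 0) / (z - 0))"
    by (auto simp: Q_def fun_eq_iff)
  then have holQ: "Q holomorphic_on ?B"
    by (simp only:) (rule pole_lemma_open; intro holomorphic_intros open_ball)
  have Q0: "Q z \<noteq> 0" if z: "z \<in> ?B" for z
  proof (cases "z = 0")
    case False
    have "exp (- z) \<noteq> 1"
    proof
      assume "exp (- z) = 1"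
      then obtain n :: int where n: "Re z = 0" "- Im z = of_int (2 * n) * pi"
        by (auto simp: exp_eq_1)
      with False have "n \<noteq> 0" by (auto simp: complex_eq_iff)
      then have "1 \<le> \<bar>real_of_int n\<bar>" by linarith
      then have "2 * pi \<le> \<bar>- Im z\<bar>" by (simp add: n(2) abs_mult)
      then have "2 * pi \<le> \<bar>Im z\<bar>" by simp
      also have "\<dots> \<le> norm z" by (rule abs_Im_le_cmod)
      finally show False using z by simp
    qed
    then show ?thesis using False by (simp add: Q_def)
  qed (simp add: Q_def)
  obtain g where holg: "g holomorphic_on ?B" and g: "\<And>z. z \<in> ?B \<Longrightarrow> exp (g z) = Q z"
    using holomorphic_logarithm_exists[OF convex_ball open_ball holQ Q0, of 0] pi_gt_zero by auto
  have g0: "exp (g 0) = 1" using g[of 0] by (simp add: Q_def)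
  then have Re_g0: "Re (g 0) = 0" by (metis exp_eq_1)
  define H where "H = (\<lambda>z. exp (- of_real \<alpha> * (g z - g 0)))"
  \<comment> \<open>On the real axis the logarithm, shifted to vanish at 0, stays real: its imaginary part
    is continuous and a multiple of \<open>2 * pi\<close>.\<close>
  have Qx: "Q (of_real x) = of_real (if x = 0 then 1 else (1 - exp (- x)) / x)" for x
    by (simp add: Q_def exp_of_real[symmetric])
  have Qpos: "(if x = 0 then 1 else (1 - exp (- x)) / x) > 0" for x :: real
    by (auto simp: divide_simps)
  define \<phi> where "\<phi> x = Im (g (of_real x) - g 0)" for x :: real
  have expg: "exp (g (of_real x) - g 0) = of_real (if x = 0 then 1 else (1 - exp (- x)) / x)"
    if "\<bar>x\<bar> < 2 * pi" for x
    using g[of "of_real x"] that by (simp add: exp_diff g0 Qx)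
  have cos_\<phi>: "cos (\<phi> x) > 0" if "\<bar>x\<bar> < 2 * pi" for x
  proof -
    have "Re (exp (g (of_real x) - g 0)) > 0"
      by (subst expg[OF that]) (use Qpos[of x] in simp)
    then show ?thesis by (simp add: Re_exp \<phi>_def zero_less_mult_iff del: minus_complex.sel)
  qed
  have sin_\<phi>: "sin (\<phi> x) = 0" if "\<bar>x\<bar> < 2 * pi" for x
  proof -
    have "Im (exp (g (of_real x) - g 0)) = 0"
      by (subst expg[OF that]) simp
    then show ?thesis by (simp add: Im_exp \<phi>_def del: minus_complex.sel)
  qed
  have cont\<phi>: "continuous_on {-2 * pi<..<2 * pi} \<phi>"
    unfolding \<phi>_def
    by (intro continuous_intros continuous_on_compose2[OF holomorphic_on_imp_continuous_on[OF holg]])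
       auto
  have \<phi>0: "\<phi> x = 0" if x: "\<bar>x\<bar> < 2 * pi" for x
  proof (rule ccontr)
    assume "\<phi> x \<noteq> 0"
    have "connected (\<phi> ` {-2 * pi<..<2 * pi})"
      by (intro connected_continuous_image cont\<phi>) simp
    then have int: "\<And>a b c. a \<in> \<phi> ` {-2 * pi<..<2 * pi} \<Longrightarrow> b \<in> \<phi> ` {-2 * pi<..<2 * pi}
        \<Longrightarrow> a \<le> c \<Longrightarrow> c \<le> b \<Longrightarrow> c \<in> \<phi> ` {-2 * pi<..<2 * pi}"
      by (auto simp: connected_iff_interval)
    have mem: "0 \<in> \<phi> ` {-2 * pi<..<2 * pi}" "\<phi> x \<in> \<phi> ` {-2 * pi<..<2 * pi}"
    proof -
      have "\<phi> 0 = 0" by (simp add: \<phi>_def)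
      then show "0 \<in> \<phi> ` {-2 * pi<..<2 * pi}" by (intro image_eqI[of _ _ 0]) auto
      show "\<phi> x \<in> \<phi> ` {-2 * pi<..<2 * pi}" using x by (intro imageI) auto
    qed
    obtain k :: int where k: "\<phi> x = of_int k * pi"
      using sin_\<phi>[OF x] by (auto simp: sin_zero_iff_int2)
    then have "k \<noteq> 0" using \<open>\<phi> x \<noteq> 0\<close> by auto
    then consider "k \<ge> 1" | "k \<le> -1" by linarith
    then obtain y where y: "\<bar>y\<bar> < 2 * pi" "\<bar>\<phi> y\<bar> = pi"
    proof cases
      case 1
      have "pi \<in> \<phi> ` {-2 * pi<..<2 * pi}" by (rule int[OF mem]) (use 1 k in auto)
      then obtain y where "y \<in> {-2 * pi<..<2 * pi}" "\<phi> y = pi" by (metis imageE)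
      then show ?thesis by (intro that[of y]) auto
    next
      case 2
      have "-pi \<in> \<phi> ` {-2 * pi<..<2 * pi}"
      proof (rule int[OF mem(2,1)])
        have "real_of_int k * pi \<le> (-1) * pi"
          by (rule mult_right_mono) (use 2 in auto)
        then show "\<phi> x \<le> -pi" using k by simp
      qed simp
      then obtain y where "y \<in> {-2 * pi<..<2 * pi}" "\<phi> y = - pi" by (metis imageE)
      then show ?thesis by (intro that[of y]) auto
    qed
    have "cos (\<phi> y) = -1" using y(2) by (metis cos_abs_real cos_pi)
    with cos_\<phi>[OF y(1)] show False by simp
  qed
  show ?thesis
  proof (rule that)
    show "H holomorphic_on ?B" unfolding H_def
      by (intro holomorphic_intros holg)
    show "norm (H z) = norm ((1 - exp (- z)) / z) powr - \<alpha>" if z: "norm z < 2 * pi" "z \<noteq> 0" for z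
    proof -
      have "norm ((1 - exp (- z)) / z) = norm (exp (g z))"
        using g[of z] z by (simp add: Q_def)
      then have "norm ((1 - exp (- z)) / z) = exp (Re (g z))" by simp
      then show ?thesis by (simp add: H_def Re_g0 powr_def)
    qed
    show "H (of_real x) = of_real (todd_powr \<alpha> x)" if x: "\<bar>x\<bar> < 2 * pi" for x
    proof -
      define q where "q = (if x = 0 then 1 else (1 - exp (- x)) / x)"
      have q: "q > 0" unfolding q_def by (rule Qpos)
      have real: "g (of_real x) - g 0 = of_real (Re (g (of_real x)))"
        using \<phi>0[OF x] by (simp add: \<phi>_def complex_eq_iff Re_g0)
      have "complex_of_real (exp (Re (g (of_real x)))) = of_real q"
        using expg[OF x] unfolding real q_def by (simp add: exp_of_real)
      then have "exp (Re (g (of_real x))) = q" by (simp only: of_real_eq_iff)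
      then have "Re (g (of_real x)) = ln q" by (metis ln_exp)
      then have "H (of_real x) = of_real (q powr - \<alpha>)"
        using q by (simp add: H_def real powr_def exp_of_real[symmetric])
      also have "q powr - \<alpha> = todd_powr \<alpha> x"
      proof (cases "x = 0")
        case False
        have "q powr - \<alpha> = inverse q powr \<alpha>"
          using q by (simp add: powr_minus inverse_powr)
        then show ?thesis using False by (simp add: todd_powr_def q_def)
      qed (simp add: todd_powr_def q_def)
      finally show ?thesis .
    qed
  qed
qed

text \<open>If all coefficients were nonnegative, the values of the series on the imaginary axis would be
  bounded by those on the positive real axis, which stay bounded up to \<open>2 * pi\<close>. The norm on
  the imaginary axis is \<open>(y / norm (1 - exp (- \<i> * y))) powr \<alpha>\<close>, which is
  unbounded as \<open>y\<close> tends to \<open>2 * pi\<close>.\<close>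

lemma todd_powr_series_has_negative_coeff:
  assumes "0 < \<alpha>"
  obtains r where "\<And>x. \<bar>x\<bar> < 2 * pi \<Longrightarrow> (\<lambda>n. r n * x ^ n) sums todd_powr \<alpha> x"
    and "\<exists>n. r n < 0"
proof -
  obtain H where holH: "H holomorphic_on ball 0 (2 * pi)"
    and Hreal: "\<And>x. \<bar>x\<bar> < 2 * pi \<Longrightarrow> H (complex_of_real x) = of_real (todd_powr \<alpha> x)"
    and Hnorm: "\<And>z. norm z < 2 * pi \<Longrightarrow> z \<noteq> 0 \<Longrightarrow> norm (H z) = norm ((1 - exp (- z)) / z) powr - \<alpha>"
    by (rule todd_powr_holomorphic_extension[of \<alpha>], rule that; assumption)
  define c where "c n = (deriv ^^ n) H 0 / fact n" for n
  have c: "(\<lambda>n. c n * z ^ n) sums H z" if "norm z < 2 * pi" for z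
    using holomorphic_power_series[OF holH, of z] that by (simp add: c_def)
  define r where "r n = Re (c n)" for n
  have r: "(\<lambda>n. r n * x ^ n) sums todd_powr \<alpha> x" if "\<bar>x\<bar> < 2 * pi" for x
    using sums_Re[OF c[of "of_real x"]] that by (simp add: r_def Hreal of_real_power[symmetric] del: of_real_power)
  have im: "(\<lambda>n. Im (c n) * x ^ n) sums 0" if "\<bar>x\<bar> < 2 * pi" for x :: real
    using sums_Im[OF c[of "of_real x"]] that by (simp add: Hreal of_real_power[symmetric] del: of_real_power)
  have Im_c: "Im (c m) = 0" for m
  proof (cases "m = 0")
    case True
    then show ?thesis using im[of 0] pi_gt_zero sums_unique2[OF powser_sums_zero[of "\<lambda>n. Im (c n)"]]
      by fastforce
  next
    case False
    show ?thesis
    proof (rule ccontr)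
      assume m: "Im (c m) \<noteq> 0"
      obtain s :: real where "s > 0" and s: "\<And>z::real. z \<in> cball 0 s - {0} \<Longrightarrow> (\<lambda>_. 0::real) z \<noteq> 0"
        by (rule powser_0_nonzero[of "2 * pi" 0 "\<lambda>n. Im (c n)" "\<lambda>_. 0" m]) (use im False m in auto)
      from s[of s] \<open>s > 0\<close> show False by simp
    qed
  qed
  then have c_r: "c n = of_real (r n)" for n by (simp add: r_def complex_eq_iff)
  have "\<exists>n. r n < 0"
  proof (rule ccontr)
    assume "\<not> (\<exists>n. r n < 0)"
    then have nn: "r n \<ge> 0" for n by (simp add: not_less)
    \<comment> \<open>A bound for the values at real \<open>y\<close> between 1 and
      \<open>2 * pi\<close>: the numerator is at most \<open>2 * pi\<close> and the denominator at least
      \<open>1 - exp (- 1)\<close>.\<close>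
    define B where "B = (2 * pi / (1 - exp (- 1))) powr \<alpha>"
    have bound: "norm (exp (- (\<i> * of_real y)) - 1) powr \<alpha> * B \<ge> y powr \<alpha>" if y: "1 < y" "y < 2 * pi" for y :: real
    proof -
      have nz: "norm (\<i> * of_real y :: complex) = y" using y by (simp add: norm_mult)
      have "norm (H (\<i> * of_real y)) \<le> todd_powr \<alpha> y"
      proof -
        have s1: "(\<lambda>n. norm (c n * (\<i> * of_real y) ^ n)) sums todd_powr \<alpha> y"
          using r[of y] y by (simp add: c_r norm_mult norm_power nn)
        have "norm (\<Sum>n. c n * (\<i> * of_real y) ^ n) \<le> (\<Sum>n. norm (c n * (\<i> * of_real y) ^ n))"
          by (rule summable_norm) (use s1 in \<open>rule sums_summable\<close>)
        then show ?thesis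
          using s1 c[of "\<i> * of_real y"] y nz by (simp add: sums_iff)
      qed
      also have "todd_powr \<alpha> y \<le> B"
        using y assms unfolding todd_powr_def B_def
        by (auto intro!: powr_mono2 frac_le)
      finally have "norm ((1 - exp (- (\<i> * of_real y))) / (\<i> * of_real y)) powr - \<alpha> \<le> B"
        using Hnorm[of "\<i> * of_real y"] y nz by auto
      moreover have "norm ((1 - exp (- (\<i> * of_real y))) / (\<i> * of_real y)) powr - \<alpha>
          = y powr \<alpha> / norm (exp (- (\<i> * of_real y)) - 1) powr \<alpha>"
        using y nz by (simp add: norm_divide powr_divide powr_minus norm_minus_commute field_simps)
      ultimately have quot: "y powr \<alpha> / norm (exp (- (\<i> * of_real y)) - 1) powr \<alpha> \<le> B" by simp
      show ?thesis
      proof (cases "norm (exp (- (\<i> * of_real y)) - 1) powr \<alpha> = 0")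
        case True
        then have "exp (- (\<i> * of_real y)) = 1" by simp
        then obtain n :: int where n: "- y = of_int (2 * n) * pi" by (auto simp: exp_eq_1)
        have "real_of_int n < 0"
          using n y by (smt (verit) mult_nonneg_nonneg of_int_0_le_iff pi_ge_zero of_int_mult)
        then have "n \<le> -1" by simp
        then have "of_int n \<le> (-1::real)" by linarith
        then have "of_int n * (2 * pi) \<le> (-1) * (2 * pi)" by (intro mult_right_mono) auto
        then have False using n y by (simp add: algebra_simps)
        then show ?thesis ..
      next
        case False
        then have "norm (exp (- (\<i> * of_real y)) - 1) powr \<alpha> > 0"
          using powr_ge_zero[of "norm (exp (- (\<i> * of_real y)) - 1)" \<alpha>] by linarith
        then show ?thesis using quot by (simp add: field_simps)
      qed
    qed
    have *: "((\<lambda>y. norm (exp (- (\<i> * of_real y)) - 1) powr \<alpha> * B) \<longlongrightarrow> 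
        norm (exp (- (\<i> * of_real (2 * pi))) - 1) powr \<alpha> * B) (at_left (2 * pi))"
      by (intro tendsto_intros) (use assms in auto)
    have "((\<lambda>y. y powr \<alpha>) \<longlongrightarrow> (2 * pi) powr \<alpha>) (at_left (2 * pi))"
      by (intro tendsto_intros) auto
    moreover have "eventually (\<lambda>y. y powr \<alpha> \<le> norm (exp (- (\<i> * of_real y)) - 1) powr \<alpha> * B) (at_left (2 * pi))"
      using eventually_at_left_real[of 1 "2 * pi"] pi_gt3 by (auto elim!: eventually_mono intro: bound)
    ultimately have "(2 * pi) powr \<alpha> \<le> norm (exp (- (\<i> * of_real (2 * pi))) - 1) powr \<alpha> * B"
      using * by (intro tendsto_le[OF trivial_limit_at_left_real])
    moreover have "exp (- (\<i> * of_real (2 * pi))) = (1::complex)"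
      unfolding exp_eq_1 by (auto intro!: exI[of _ "-1"])
    ultimately show False by simp
  qed
  with r show ?thesis by (rule that)
qed

lemma todd_powr_at_minus:
  assumes "v > 0"
  shows "todd_powr \<alpha> (- v) = (v / (exp v - 1)) powr \<alpha>"
  using assms by (simp add: todd_powr_def minus_divide_left[symmetric] minus_divide_right)

lemma todd_powr_nonneg: "todd_powr \<alpha> x \<ge> 0"
  by (simp add: todd_powr_def)

lemma todd_powr_measurable [measurable]: "todd_powr \<alpha> \<in> borel_measurable borel"
  unfolding todd_powr_def by measurable

text \<open>Convexity of exp gives \<open>exp (l * b) - 1 \<le> l * (exp b - 1)\<close> for
  \<open>l = a / b\<close>, so \<open>v / (exp v - 1)\<close> decreases.\<close>

lemma todd_powr_antimono:
  assumes "0 < \<alpha>" "0 \<le> a" "a \<le> b"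
  shows "todd_powr \<alpha> (- b) \<le> todd_powr \<alpha> (- a)"
proof -
  have le1: "v / (exp v - 1) \<le> 1" if "v > 0" for v :: real
    using that exp_ge_add_one_self[of v] by (simp add: divide_simps del: exp_ge_add_one_self)
  consider "b = 0" | "a = 0" "b > 0" | "a > 0" using assms by linarith
  then show ?thesis
  proof cases
    case 2
    then have "(b / (exp b - 1)) powr \<alpha> \<le> 1 powr \<alpha>"
      using assms le1[of b] by (intro powr_mono2) auto
    then show ?thesis using 2 by (simp add: todd_powr_at_minus) (simp add: todd_powr_def)
  next
    case 3
    then have b: "b > 0" using assms by simp
    define l where "l = a / b"
    have l: "0 \<le> l" "l \<le> 1" "l * b = a" using 3 b assms by (auto simp: l_def divide_simps)
    have "exp ((1 - l) *\<^sub>R 0 + l *\<^sub>R b) \<le> (1 - l) * exp 0 + l * exp b"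
      by (rule convex_onD[OF exp_convex]) (use l in auto)
    then have "exp a \<le> (1 - l) + l * exp b" using l by simp
    then have "exp a - 1 \<le> l * (exp b - 1)" by (simp add: algebra_simps)
    then have "b * (exp a - 1) \<le> a * (exp b - 1)" using b by (simp add: l_def divide_simps mult.commute)
    then have "b / (exp b - 1) \<le> a / (exp a - 1)" using b 3 by (simp add: divide_simps)
    then have "(b / (exp b - 1)) powr \<alpha> \<le> (a / (exp a - 1)) powr \<alpha>"
      using assms b by (intro powr_mono2) auto
    then show ?thesis using 3 b by (simp add: todd_powr_at_minus)
  qed (use assms in auto)
qed

lemma todd_powr_le_1:
  assumes "0 < \<alpha>" "0 \<le> v"
  shows "todd_powr \<alpha> (- v) \<le> 1"
  using todd_powr_antimono[of \<alpha> 0 v] assms by (simp add: todd_powr_def)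

lemma isCont_todd_powr:
  assumes "0 < \<alpha>"
  shows "isCont (todd_powr \<alpha>) x"
proof (cases "x = 0")
  case False
  have "isCont (\<lambda>x. (x / (1 - exp (- x))) powr \<alpha>) x"
    using False by (intro continuous_intros) auto
  moreover have "eventually (\<lambda>y. (y / (1 - exp (- y))) powr \<alpha> = todd_powr \<alpha> y) (nhds x)"
    using eventually_nhds_in_open[of "-{0}" x] False
    by (auto elim!: eventually_mono simp: todd_powr_def)
  ultimately show ?thesis using isCont_cong by fast
next
  case True
  have "((\<lambda>x::real. 1 - exp (- x)) has_field_derivative 1) (at 0)"
    by (auto intro!: derivative_eq_intros)
  then have "(\<lambda>x::real. (1 - exp (- x)) / x) \<midarrow>0\<rightarrow> 1"
    by (simp add: has_field_derivative_iff)
  then have "(\<lambda>x::real. inverse ((1 - exp (- x)) / x) powr \<alpha>) \<midarrow>0\<rightarrow> inverse 1 powr \<alpha>"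
    by (intro tendsto_intros) auto
  then have "(\<lambda>x. (x / (1 - exp (- x))) powr \<alpha>) \<midarrow>0\<rightarrow> 1" by simp
  then have "todd_powr \<alpha> \<midarrow>0\<rightarrow> 1"
    by (rule Lim_transform_eventually) (auto simp: eventually_at_filter todd_powr_def)
  then show ?thesis by (simp add: True isCont_def todd_powr_def)
qed

lemma todd_powr_tendsto_0:
  assumes "0 < \<alpha>"
  shows "((\<lambda>v. todd_powr \<alpha> (- v)) \<longlongrightarrow> 0) at_top"
proof (rule tendsto_sandwich[where f="\<lambda>_. 0" and h="\<lambda>v. (2 / v) powr \<alpha>"])
  show "((\<lambda>v. (2 / v) powr \<alpha>) \<longlongrightarrow> 0) at_top"
  proof -
    have "((\<lambda>v::real. 2 / v) \<longlongrightarrow> 0) at_top"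
      by (rule tendsto_divide_0[OF tendsto_const filterlim_at_top_imp_at_infinity[OF filterlim_ident]])
    then have "((\<lambda>v::real. (2 / v) powr \<alpha>) \<longlongrightarrow> 0 powr \<alpha>) at_top"
      by (rule tendsto_powr2) (use assms in \<open>auto intro!: eventually_mono[OF eventually_gt_at_top[of 0]]\<close>)
    then show ?thesis by simp
  qed
  show "eventually (\<lambda>v. todd_powr \<alpha> (- v) \<le> (2 / v) powr \<alpha>) at_top"
    using eventually_gt_at_top[of 0]
  proof eventually_elim
    case (elim v)
    have "v\<^sup>2 / 2 \<le> exp v - 1" using exp_lower_Taylor_quadratic[of v] elim by simp
    then have "v / (exp v - 1) \<le> 2 / v" using elim by (simp add: divide_simps power2_eq_square)
    then have "(v / (exp v - 1)) powr \<alpha> \<le> (2 / v) powr \<alpha>"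
      using elim assms by (intro powr_mono2) auto
    then show ?case using elim by (simp add: todd_powr_at_minus)
  qed
qed (auto intro: todd_powr_nonneg always_eventually)

section \<open>The function J and the measure with tails J\<close>

text \<open>The density of the Beta distribution with parameters \<open>1 - \<alpha>\<close> and
  \<open>\<alpha>\<close>, up to normalization. It appears when the convolution J on
  \<open>(0, t)\<close> is rescaled to the unit interval.\<close>

definition beta_weight :: "real \<Rightarrow> real \<Rightarrow> real" where
  "beta_weight \<alpha> s = indicator {0<..<1} s * (s powr - \<alpha> * (1 - s) powr (\<alpha> - 1))"

lemma beta_weight_nonneg: "beta_weight \<alpha> s \<ge> 0"
  by (simp add: beta_weight_def)

lemma beta_weight_measurable [measurable]: "beta_weight \<alpha> \<in> borel_measurable borel"
  unfolding beta_weight_def by measurable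

lemma beta_weight_moment:
  assumes "0 < \<alpha>" "\<alpha> < 1"
  shows "has_bochner_integral lborel (\<lambda>s. beta_weight \<alpha> s * s ^ n) (Beta (real n + 1 - \<alpha>) \<alpha>)"
    and "0 < Beta (real n + 1 - \<alpha>) \<alpha>"
proof -
  let ?f = "\<lambda>s::real. s powr (real n + 1 - \<alpha> - 1) * (1 - s) powr (\<alpha> - 1)"
  have "Gamma (real n + 1 - \<alpha>) > 0" "Gamma \<alpha> > 0" "Gamma (real n + 1 - \<alpha> + \<alpha>) > 0"
    using assms by (intro Gamma_real_pos; simp)+
  then show pos: "0 < Beta (real n + 1 - \<alpha>) \<alpha>" by (simp add: Beta_def)
  have "(?f has_integral Beta (real n + 1 - \<alpha>) \<alpha>) {0..1}"
    by (rule has_integral_Beta_real) (use assms in auto)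
  then have "(?f has_integral Beta (real n + 1 - \<alpha>) \<alpha>) {0<..<1}"
    by (simp only: has_integral_Icc_iff_Ioo)
  then have nn: "(\<integral>\<^sup>+s. ennreal (indicator {0<..<1} s * ?f s) \<partial>lborel) = ennreal (Beta (real n + 1 - \<alpha>) \<alpha>)"
    by (rule nn_integral_has_integral_lebesgue[rotated]) auto
  have eq: "indicator {0<..<1} s * ?f s = beta_weight \<alpha> s * s ^ n" for s
  proof (cases "s \<in> {0<..<1}")
    case True
    then have "s powr (real n + 1 - \<alpha> - 1) = s powr - \<alpha> * s ^ n"
      by (simp add: powr_diff powr_minus powr_realpow divide_inverse mult.commute)
    then show ?thesis using True by (simp add: beta_weight_def mult_ac)
  qed (simp add: beta_weight_def)
  show "has_bochner_integral lborel (\<lambda>s. beta_weight \<alpha> s * s ^ n) (Beta (real n + 1 - \<alpha>) \<alpha>)"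
  proof (rule has_bochner_integral_nn_integral)
    show "(\<integral>\<^sup>+s. ennreal (beta_weight \<alpha> s * s ^ n) \<partial>lborel) = ennreal (Beta (real n + 1 - \<alpha>) \<alpha>)"
      using nn by (simp only: eq)
    show "AE s in lborel. 0 \<le> beta_weight \<alpha> s * s ^ n"
      by (intro AE_I2) (simp add: eq[symmetric])
  qed (use pos in auto)
qed

lemma beta_weight_integrable:
  assumes "0 < \<alpha>" "\<alpha> < 1"
  shows "integrable lborel (beta_weight \<alpha>)"
  using beta_weight_moment(1)[OF assms, of 0] by (simp add: has_bochner_integral_iff)

text \<open>The continuous extension of J to the whole line, constant on the nonpositive half-axis, in
  the rescaled form. In this form t occurs only inside a bounded monotone factor of the integrand, so
  that monotonicity, continuity and the limits at 0 and at infinity can be read off by dominated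
  convergence.\<close>

definition J_ext :: "real \<Rightarrow> real \<Rightarrow> real" where
  "J_ext \<alpha> t = (LINT s|lborel. beta_weight \<alpha> s * todd_powr \<alpha> (- (max 0 t * s)))"

lemma beta_weight_todd_bound:
  assumes "0 < \<alpha>" "0 \<le> t"
  shows "norm (beta_weight \<alpha> s * todd_powr \<alpha> (- (t * s))) \<le> beta_weight \<alpha> s"
proof (cases "s > 0")
  case True
  then have "todd_powr \<alpha> (- (t * s)) \<le> 1" using assms by (intro todd_powr_le_1) auto
  then show ?thesis
    using todd_powr_nonneg[of \<alpha> "- (t * s)"] beta_weight_nonneg[of \<alpha> s]
    by (simp add: mult_left_le)
qed (simp add: beta_weight_def)

lemma beta_weight_todd_integrable:
  assumes "0 < \<alpha>" "\<alpha> < 1" "0 \<le> t"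
  shows "integrable lborel (\<lambda>s. beta_weight \<alpha> s * todd_powr \<alpha> (- (t * s)))"
  by (rule Bochner_Integration.integrable_bound[OF beta_weight_integrable[OF assms(1,2)]])
     (use beta_weight_todd_bound[OF assms(1,3)] in \<open>auto intro!: AE_I2 simp: beta_weight_nonneg\<close>)

text \<open>Substitute \<open>u = t * s\<close>. Splitting \<open>exp u - 1\<close> into u and a Todd
  factor, the powers of t that come from \<open>t - u\<close>, from u and from the Jacobian cancel: their
  exponents \<open>\<alpha> - 1\<close>, \<open>- \<alpha>\<close> and 1 add up to 0.\<close>

lemma J_alpha_rescaled:
  assumes "0 < \<alpha>" "\<alpha> < 1" "0 < t"
  shows "set_integrable lborel {0<..<t} (\<lambda>u. (t - u) powr (\<alpha> - 1) * (exp u - 1) powr - \<alpha>)"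
    and "J_alpha \<alpha> t = J_ext \<alpha> t"
proof -
  let ?f = "\<lambda>u. indicator {0<..<t} u *\<^sub>R ((t - u) powr (\<alpha> - 1) * (exp u - 1) powr - \<alpha>)"
  let ?g = "\<lambda>s. beta_weight \<alpha> s * todd_powr \<alpha> (- (t * s))"
  have eq: "t * ?f (0 + t * s) = ?g s" for s
  proof (cases "s \<in> {0<..<1}")
    case True
    then have s: "0 < s" "s < 1" by auto
    have e: "exp (t * s) > 1" using s assms by simp
    have a: "t * (t - t * s) powr (\<alpha> - 1) = t powr \<alpha> * (1 - s) powr (\<alpha> - 1)"
    proof -
      have "(t - t * s) powr (\<alpha> - 1) = t powr (\<alpha> - 1) * (1 - s) powr (\<alpha> - 1)"
        using assms s by (simp add: powr_mult[symmetric] right_diff_distrib)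
      moreover have "t * t powr (\<alpha> - 1) = t powr \<alpha>"
        using assms by (simp add: powr_diff)
      ultimately show ?thesis by (simp add: mult.assoc[symmetric])
    qed
    have b: "todd_powr \<alpha> (- (t * s)) = t powr \<alpha> * s powr \<alpha> * (exp (t * s) - 1) powr - \<alpha>"
    proof -
      have "t * s > 0" using assms s by simp
      then have "todd_powr \<alpha> (- (t * s)) = (t * s) powr \<alpha> / (exp (t * s) - 1) powr \<alpha>"
        using e by (simp only: todd_powr_at_minus) (intro powr_divide; simp)
      then show ?thesis using assms s
        by (simp only: powr_mult powr_minus divide_inverse order.strict_implies_order)
    qed
    have "s powr - \<alpha> * s powr \<alpha> = 1" using s by (simp add: powr_minus)
    then have "beta_weight \<alpha> s * todd_powr \<alpha> (- (t * s))
        = t powr \<alpha> * (1 - s) powr (\<alpha> - 1) * (exp (t * s) - 1) powr - \<alpha>"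
      using s unfolding beta_weight_def b by (simp add: algebra_simps)
    moreover have "t * ?f (0 + t * s) = t * (t - t * s) powr (\<alpha> - 1) * (exp (t * s) - 1) powr - \<alpha>"
      using s assms by simp
    ultimately show ?thesis by (simp only: a)
  next
    case False
    then have "0 + t * s \<notin> {0<..<t}" using assms by (auto simp: zero_less_mult_iff)
    then show ?thesis using False by (simp add: beta_weight_def)
  qed
  have "integrable lborel (\<lambda>s. t * ?f (0 + t * s))"
    unfolding eq by (rule beta_weight_todd_integrable) (use assms in auto)
  then have "integrable lborel (\<lambda>s. ?f (0 + t * s))" using assms by simp
  then have int: "integrable lborel ?f"
    using assms by (subst (asm) lborel_integrable_real_affine_iff) auto
  then show "set_integrable lborel {0<..<t} (\<lambda>u. (t - u) powr (\<alpha> - 1) * (exp u - 1) powr - \<alpha>)"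
    by (simp add: set_integrable_def)
  have "J_alpha \<alpha> t = integral\<^sup>L lborel ?f"
    by (simp add: J_alpha_def set_lebesgue_integral_def)
  also have "\<dots> = \<bar>t\<bar> *\<^sub>R (LINT s|lborel. ?f (0 + t * s))"
    by (rule lborel_integral_real_affine) (use assms in auto)
  also have "\<dots> = (LINT s|lborel. t * ?f (0 + t * s))" using assms by simp
  also have "\<dots> = J_ext \<alpha> t" unfolding eq using assms by (simp add: J_ext_def)
  finally show "J_alpha \<alpha> t = J_ext \<alpha> t" .
qed

lemma J_ext_antimono:
  assumes "0 < \<alpha>" "\<alpha> < 1" "s \<le> t"
  shows "J_ext \<alpha> t \<le> J_ext \<alpha> s"
  unfolding J_ext_def
proof (rule integral_mono)
  fix v :: real
  show "beta_weight \<alpha> v * todd_powr \<alpha> (- (max 0 t * v)) \<le> beta_weight \<alpha> v * todd_powr \<alpha> (- (max 0 s * v))"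
  proof (cases "v > 0")
    case True
    then show ?thesis using assms
      by (intro mult_left_mono todd_powr_antimono beta_weight_nonneg mult_right_mono) auto
  qed (simp add: beta_weight_def)
qed (use assms in \<open>auto intro!: beta_weight_todd_integrable\<close>)

text \<open>Since the Todd factor is at most 1 for nonpositive arguments, the weight itself dominates the
  integrands. Continuity of J and its vanishing at infinity are both instances.\<close>

lemma J_ext_limit:
  assumes "0 < \<alpha>" "\<alpha> < 1"
    and lim: "\<And>s. 0 < s \<Longrightarrow> (\<lambda>n. todd_powr \<alpha> (- (max 0 (X n) * s))) \<longlonglongrightarrow> g s"
    and [measurable]: "g \<in> borel_measurable borel"
  shows "(\<lambda>n. J_ext \<alpha> (X n)) \<longlonglongrightarrow> (LINT s|lborel. beta_weight \<alpha> s * g s)"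
  unfolding J_ext_def
proof (rule integral_dominated_convergence)
  show "integrable lborel (beta_weight \<alpha>)" by (rule beta_weight_integrable) fact+
  show "AE s in lborel. (\<lambda>n. beta_weight \<alpha> s * todd_powr \<alpha> (- (max 0 (X n) * s))) \<longlonglongrightarrow> beta_weight \<alpha> s * g s"
  proof (rule AE_I2)
    fix s :: real
    show "(\<lambda>n. beta_weight \<alpha> s * todd_powr \<alpha> (- (max 0 (X n) * s))) \<longlonglongrightarrow> beta_weight \<alpha> s * g s"
    proof (cases "s > 0")
      case True
      then show ?thesis by (intro tendsto_mult tendsto_const lim)
    qed (simp add: beta_weight_def)
  qed
  show "AE s in lborel. norm (beta_weight \<alpha> s * todd_powr \<alpha> (- (max 0 (X n) * s))) \<le> beta_weight \<alpha> s" for n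
    by (intro AE_I2 beta_weight_todd_bound) (use assms in auto)
qed measurable

lemma isCont_J_ext:
  assumes "0 < \<alpha>" "\<alpha> < 1"
  shows "isCont (J_ext \<alpha>) t"
  unfolding continuous_at_sequentially comp_def
proof (intro allI impI)
  fix X assume X: "X \<longlonglongrightarrow> t"
  have "(\<lambda>n. J_ext \<alpha> (X n)) \<longlonglongrightarrow> (LINT s|lborel. beta_weight \<alpha> s * todd_powr \<alpha> (- (max 0 t * s)))"
  proof (rule J_ext_limit[OF assms])
    show "(\<lambda>n. todd_powr \<alpha> (- (max 0 (X n) * s))) \<longlonglongrightarrow> todd_powr \<alpha> (- (max 0 t * s))" for s
      by (rule isCont_tendsto_compose[OF isCont_todd_powr[OF assms(1)]]) (intro tendsto_intros X)
  qed measurable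
  then show "(\<lambda>n. J_ext \<alpha> (X n)) \<longlonglongrightarrow> J_ext \<alpha> t" by (simp only: J_ext_def)
qed

lemma J_ext_tendsto_0:
  assumes "0 < \<alpha>" "\<alpha> < 1"
  shows "(\<lambda>n. J_ext \<alpha> (t + real n)) \<longlonglongrightarrow> 0"
proof -
  have "(\<lambda>n. J_ext \<alpha> (t + real n)) \<longlonglongrightarrow> (LINT s|lborel. beta_weight \<alpha> s * 0)"
  proof (rule J_ext_limit[OF assms])
    fix s :: real assume s: "0 < s"
    have "filterlim (\<lambda>n. max 0 (t + real n) * s) at_top sequentially"
    proof (rule filterlim_at_top_mono)
      show "filterlim (\<lambda>n. s * (t + real n)) at_top sequentially"
        by (intro filterlim_tendsto_pos_mult_at_top[OF tendsto_const s] 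
              filterlim_tendsto_add_at_top[OF tendsto_const] filterlim_real_sequentially)
      show "eventually (\<lambda>n. s * (t + real n) \<le> max 0 (t + real n) * s) sequentially"
        using s by (intro always_eventually) (auto simp: mult.commute)
    qed
    then show "(\<lambda>n. todd_powr \<alpha> (- (max 0 (t + real n) * s))) \<longlonglongrightarrow> 0"
      by (rule filterlim_compose[OF todd_powr_tendsto_0[OF assms(1)]])
  qed simp
  then show ?thesis by simp
qed

lemma J_ext_nonneg: "J_ext \<alpha> t \<ge> 0"
  unfolding J_ext_def by (intro integral_nonneg_AE AE_I2 mult_nonneg_nonneg beta_weight_nonneg todd_powr_nonneg)

lemma mu_alpha_eq:
  assumes "0 < \<alpha>" "\<alpha> < 1"
  shows "mu_alpha \<alpha> = restrict_space (interval_measure (\<lambda>t. - J_ext \<alpha> t)) {0<..}"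
proof -
  have "eventually (\<lambda>t. J_ext \<alpha> t = J_alpha \<alpha> t) (at_right 0)"
    using eventually_at_right_less[of 0] by eventually_elim (use assms J_alpha_rescaled in auto)
  moreover have "(J_ext \<alpha> \<longlongrightarrow> J_ext \<alpha> 0) (at_right 0)"
    using isCont_J_ext[OF assms, of 0] by (simp add: isCont_def filterlim_at_split)
  ultimately have "(J_alpha \<alpha> \<longlongrightarrow> J_ext \<alpha> 0) (at_right 0)"
    by (rule Lim_transform_eventually[rotated])
  then have "Lim (at_right 0) (J_alpha \<alpha>) = J_ext \<alpha> 0"
    by (intro tendsto_Lim) auto
  moreover have "J_ext \<alpha> 0 = J_ext \<alpha> t" if "t \<le> 0" for t using that by (simp add: J_ext_def)
  ultimately have "(if t > 0 then J_alpha \<alpha> t else Lim (at_right 0) (J_alpha \<alpha>)) = J_ext \<alpha> t" for t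
    using J_alpha_rescaled(2)[OF assms, of t] by (cases "t > 0") auto
  then show ?thesis by (simp only: mu_alpha_def)
qed

lemma space_mu_alpha [simp]: "space (mu_alpha \<alpha>) = {0<..}"
  by (simp add: mu_alpha_def space_restrict_space)

lemma sets_mu_alpha [measurable_cong]: "sets (mu_alpha \<alpha>) = sets (restrict_space borel {0<..})"
  unfolding mu_alpha_def by (intro sets_restrict_space_cong) simp

lemma emeasure_mu_alpha_Ioc:
  assumes "0 < \<alpha>" "\<alpha> < 1" "0 \<le> s" "s \<le> t"
  shows "emeasure (mu_alpha \<alpha>) {s<..t} = ennreal (J_ext \<alpha> s - J_ext \<alpha> t)"
proof -
  have "emeasure (mu_alpha \<alpha>) {s<..t} = emeasure (interval_measure (\<lambda>t. - J_ext \<alpha> t)) {s<..t}"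
    unfolding mu_alpha_eq[OF assms(1,2)] using assms by (intro emeasure_restrict_space) auto
  also have "\<dots> = ennreal (- J_ext \<alpha> t - - J_ext \<alpha> s)"
    using assms isCont_J_ext[OF assms(1,2)]
    by (intro emeasure_interval_measure_Ioc)
       (auto intro!: J_ext_antimono continuous_intros intro: continuous_at_imp_continuous_at_within)
  finally show ?thesis by simp
qed

lemma emeasure_mu_alpha_Ioi:
  assumes "0 < \<alpha>" "\<alpha> < 1" "0 \<le> s"
  shows "emeasure (mu_alpha \<alpha>) {s<..} = ennreal (J_ext \<alpha> s)"
proof (rule LIMSEQ_unique)
  have "(\<lambda>n. emeasure (mu_alpha \<alpha>) {s<..s + real n}) \<longlonglongrightarrow> emeasure (mu_alpha \<alpha>) (\<Union>n. {s<..s + real n})"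
  proof (rule Lim_emeasure_incseq)
    have "{s<..s + real n} \<in> sets (mu_alpha \<alpha>)" for n
      using assms by (subst sets_mu_alpha, subst sets_restrict_space_iff) auto
    then show "range (\<lambda>n. {s<..s + real n}) \<subseteq> sets (mu_alpha \<alpha>)" by blast
    show "incseq (\<lambda>n. {s<..s + real n})" unfolding incseq_def by auto
  qed
  also have "(\<Union>n. {s<..s + real n}) = {s<..}"
  proof -
    have "\<exists>n. x \<le> s + real n" for x using real_arch_simple[of "x - s"] by (auto simp: algebra_simps)
    then show ?thesis by auto
  qed
  finally show "(\<lambda>n. emeasure (mu_alpha \<alpha>) {s<..s + real n}) \<longlonglongrightarrow> emeasure (mu_alpha \<alpha>) {s<..}" .
  have "(\<lambda>n. ennreal (J_ext \<alpha> s - J_ext \<alpha> (s + real n))) \<longlonglongrightarrow> ennreal (J_ext \<alpha> s - 0)"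
    by (intro tendsto_ennrealI tendsto_intros J_ext_tendsto_0 assms)
  then show "(\<lambda>n. emeasure (mu_alpha \<alpha>) {s<..s + real n}) \<longlonglongrightarrow> ennreal (J_ext \<alpha> s)"
    using assms by (simp add: emeasure_mu_alpha_Ioc)
qed

lemma finite_measure_mu_alpha:
  assumes "0 < \<alpha>" "\<alpha> < 1"
  shows "finite_measure (mu_alpha \<alpha>)"
  by (rule finite_measureI) (use emeasure_mu_alpha_Ioi[OF assms, of 0] in simp)

section \<open>The Laplace transform of J\<close>

lemma nn_integral_exp_powr:
  assumes "0 < x" "0 < \<alpha>"
  shows "(\<integral>\<^sup>+v. ennreal (indicator {0<..} v * (v powr (\<alpha> - 1) * exp (- x * v))) \<partial>lborel)
    = ennreal (Gamma \<alpha> * x powr - \<alpha>)"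
proof -
  let ?g = "\<lambda>t. indicator {0..} t * t powr (\<alpha> - 1) / exp t"
  have "ennreal (Gamma \<alpha>) = (\<integral>\<^sup>+t. ennreal (?g t) \<partial>lborel)"
    by (rule Gamma_conv_nn_integral_real) fact
  also have "\<dots> = ennreal \<bar>x\<bar> * (\<integral>\<^sup>+v. ennreal (?g (0 + x * v)) \<partial>lborel)"
    by (rule nn_integral_real_affine) (use assms in auto)
  also have "(\<integral>\<^sup>+v. ennreal (?g (0 + x * v)) \<partial>lborel) 
      = (\<integral>\<^sup>+v. ennreal (x powr (\<alpha> - 1)) * ennreal (indicator {0<..} v * (v powr (\<alpha> - 1) * exp (- x * v))) \<partial>lborel)"
  proof (rule nn_integral_cong)
    fix v :: real
    consider "v > 0" | "v = 0" | "v < 0" by linarith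
    then show "ennreal (?g (0 + x * v)) = ennreal (x powr (\<alpha> - 1)) * ennreal (indicator {0<..} v * (v powr (\<alpha> - 1) * exp (- x * v)))"
    proof cases
      case 1
      then show ?thesis using assms
        by (simp add: ennreal_mult[symmetric] powr_mult exp_minus divide_inverse mult.assoc)
    next
      case 3
      then have "\<not> 0 \<le> x * v" using assms by (simp add: zero_le_mult_iff)
      then show ?thesis using 3 by simp
    qed simp
  qed
  also have "\<dots> = ennreal (x powr (\<alpha> - 1)) * (\<integral>\<^sup>+v. ennreal (indicator {0<..} v * (v powr (\<alpha> - 1) * exp (- x * v))) \<partial>lborel)"
    by (rule nn_integral_cmult) measurable
  also have "ennreal \<bar>x\<bar> * (ennreal (x powr (\<alpha> - 1)) * (\<integral>\<^sup>+v. ennreal (indicator {0<..} v * (v powr (\<alpha> - 1) * exp (- x * v))) \<partial>lborel))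
     = ennreal (x powr \<alpha>) * (\<integral>\<^sup>+v. ennreal (indicator {0<..} v * (v powr (\<alpha> - 1) * exp (- x * v))) \<partial>lborel)"
    (is "_ = _ * ?I")
    using assms by (simp add: mult.assoc[symmetric] ennreal_mult[symmetric] powr_diff)
  finally have eq: "ennreal (Gamma \<alpha>) = ennreal (x powr \<alpha>) * ?I" .
  have "ennreal (Gamma \<alpha> * x powr - \<alpha>) = ennreal (x powr - \<alpha>) * ennreal (Gamma \<alpha>)"
    using assms by (simp add: ennreal_mult'' mult.commute)
  also have "\<dots> = ennreal (x powr - \<alpha> * x powr \<alpha>) * ?I"
    by (simp add: eq mult.assoc ennreal_mult)
  also have "x powr - \<alpha> * x powr \<alpha> = 1" using assms by (simp add: powr_minus)
  finally show ?thesis by simp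
qed

text \<open>The substitution \<open>w = exp (- u)\<close> maps \<open>(0, \<infinity>)\<close> onto
  \<open>(0, 1)\<close> and turns the integral into the Beta integral with parameters
  \<open>x + \<alpha>\<close> and \<open>1 - \<alpha>\<close>.\<close>

lemma nn_integral_exp_minus_1_powr:
  assumes "0 < x" "0 < \<alpha>" "\<alpha> < 1"
  shows "(\<integral>\<^sup>+u. ennreal (indicator {0<..} u * (exp (- x * u) * (exp u - 1) powr - \<alpha>)) \<partial>lborel)
    = ennreal (Gamma (x + \<alpha>) * Gamma (1 - \<alpha>) / Gamma (x + 1))"
proof -
  let ?f = "\<lambda>w::real. w powr (x + \<alpha> - 1) * (1 - w) powr (1 - \<alpha> - 1)"
  have "(?f has_integral Beta (x + \<alpha>) (1 - \<alpha>)) {0<..<1}"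
    using has_integral_Beta_real[of "x + \<alpha>" "1 - \<alpha>"] assms
    by (simp add: has_integral_Icc_iff_Ioo)
  moreover have img: "(\<lambda>u. exp (- u)) ` {0<..} = {0<..<1::real}"
  proof (intro equalityI subsetI)
    fix w :: real assume "w \<in> {0<..<1}"
    then have "w = exp (- (- ln w))" "- ln w \<in> {0<..}" by auto
    then show "w \<in> (\<lambda>u. exp (- u)) ` {0<..}" by blast
  qed auto
  ultimately have "?f absolutely_integrable_on ((\<lambda>u. exp (- u)) ` {0<..}) 
      \<and> integral ((\<lambda>u. exp (- u)) ` {0<..}) ?f = Beta (x + \<alpha>) (1 - \<alpha>)"
    by (auto simp: has_integral_iff intro!: nonnegative_absolutely_integrable_1)
  then have "(\<lambda>u. \<bar>- exp (- u)\<bar> * ?f (exp (- u))) absolutely_integrable_on {0<..} \<and>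
      integral {0<..} (\<lambda>u. \<bar>- exp (- u)\<bar> * ?f (exp (- u))) = Beta (x + \<alpha>) (1 - \<alpha>)"
    by (subst has_absolute_integral_change_of_variables_1')
       (auto intro!: derivative_eq_intros simp: inj_on_def)
  then have "((\<lambda>u. \<bar>- exp (- u)\<bar> * ?f (exp (- u))) has_integral Beta (x + \<alpha>) (1 - \<alpha>)) {0<..}"
    by (auto simp: has_integral_iff absolutely_integrable_on_def)
  then have "(\<integral>\<^sup>+u. ennreal (indicator {0<..} u * (\<bar>- exp (- u)\<bar> * ?f (exp (- u)))) \<partial>lborel) = ennreal (Beta (x + \<alpha>) (1 - \<alpha>))"
    by (rule nn_integral_has_integral_lebesgue[rotated]) auto
  moreover have integrand: "indicator {0<..} u * (\<bar>- exp (- u)\<bar> * ?f (exp (- u)))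
      = indicator {0<..} u * (exp (- x * u) * (exp u - 1) powr - \<alpha>)" for u :: real
  proof (cases "u > 0")
    case True
    have "exp u - 1 = exp u * (1 - exp (- u))" by (simp add: algebra_simps exp_minus)
    then have "(exp u - 1) powr - \<alpha> = exp (- \<alpha> * u) * (1 - exp (- u)) powr - \<alpha>"
      using True by (simp add: powr_mult) (simp add: powr_def)
    moreover have "exp (- u) powr (x + \<alpha> - 1) = exp (- u * (x + \<alpha> - 1))"
      by (simp add: powr_def)
    moreover have "exp (- u) * exp (- u * (x + \<alpha> - 1)) = exp (- x * u) * exp (- \<alpha> * u)"
      by (simp add: exp_add[symmetric] algebra_simps)
    ultimately show ?thesis using True by (simp add: mult.assoc[symmetric])
  qed simp
  ultimately show ?thesis unfolding integrand by (simp add: Beta_def add.commute)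
qed

lemma ennreal_J_ext:
  assumes "0 < \<alpha>" "\<alpha> < 1" "0 < t"
  shows "ennreal (J_ext \<alpha> t) = (\<integral>\<^sup>+u. ennreal (indicator {0<..<t} u * ((t - u) powr (\<alpha> - 1) * (exp u - 1) powr - \<alpha>)) \<partial>lborel)"
proof -
  have "J_ext \<alpha> t = (LINT u|lborel. indicator {0<..<t} u * ((t - u) powr (\<alpha> - 1) * (exp u - 1) powr - \<alpha>))"
    using J_alpha_rescaled(2)[OF assms] by (simp add: J_alpha_def set_lebesgue_integral_def)
  moreover have "integrable lborel (\<lambda>u. indicator {0<..<t} u * ((t - u) powr (\<alpha> - 1) * (exp u - 1) powr - \<alpha>))"
    using J_alpha_rescaled(1)[OF assms] by (simp add: set_integrable_def)
  ultimately show ?thesis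
    by (simp add: nn_integral_eq_integral)
qed

text \<open>The transform of a convolution is the product of the transforms. The factor
  \<open>1 / x\<close> comes from \<open>Gamma (x + 1) = x * Gamma x\<close>.\<close>

lemma laplace_transform_J:
  assumes "0 < x" "0 < \<alpha>" "\<alpha> < 1"
  shows "(\<integral>\<^sup>+t. ennreal (indicator {0<..} t * exp (- x * t)) * ennreal (J_ext \<alpha> t) \<partial>lborel)
    = ennreal (Gamma \<alpha> * Gamma (1 - \<alpha>) * F_alpha \<alpha> x / x)"
proof -
  let ?k = "\<lambda>u. (exp u - 1) powr - \<alpha> :: real"
  let ?h = "\<lambda>t u. ennreal (indicator {0<..} u * (indicator {0<..} (t - u) * (exp (- x * t) * ((t - u) powr (\<alpha> - 1) * ?k u))))"
  have [measurable]: "case_prod ?h \<in> borel_measurable (lborel \<Otimes>\<^sub>M lborel)"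
    unfolding case_prod_unfold by measurable
  have "(\<integral>\<^sup>+t. ennreal (indicator {0<..} t * exp (- x * t)) * ennreal (J_ext \<alpha> t) \<partial>lborel)
      = (\<integral>\<^sup>+t. \<integral>\<^sup>+u. ?h t u \<partial>lborel \<partial>lborel)"
  proof (rule nn_integral_cong)
    fix t :: real
    show "ennreal (indicator {0<..} t * exp (- x * t)) * ennreal (J_ext \<alpha> t) = (\<integral>\<^sup>+u. ?h t u \<partial>lborel)"
    proof (cases "t > 0")
      case True
      then have "ennreal (indicator {0<..} t * exp (- x * t)) * ennreal (J_ext \<alpha> t)
        = (\<integral>\<^sup>+u. ennreal (indicator {0<..} t * exp (- x * t)) * ennreal (indicator {0<..<t} u * ((t - u) powr (\<alpha> - 1) * ?k u)) \<partial>lborel)"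
        using assms by (subst nn_integral_cmult) (simp_all add: ennreal_J_ext)
      also have "\<dots> = (\<integral>\<^sup>+u. ?h t u \<partial>lborel)"
        using True by (intro nn_integral_cong) (auto simp: ennreal_mult[symmetric] split: split_indicator)
      finally show ?thesis .
    next
      case False
      then have "?h t = (\<lambda>_. 0)" by (auto simp: fun_eq_iff split: split_indicator)
      then show ?thesis using False by (simp only:) simp
    qed
  qed
  also have "\<dots> = (\<integral>\<^sup>+u. \<integral>\<^sup>+t. ?h t u \<partial>lborel \<partial>lborel)"
    by (rule lborel_pair.Fubini'[symmetric]) measurable
  also have "\<dots> = (\<integral>\<^sup>+u. ennreal (indicator {0<..} u * (exp (- x * u) * ?k u)) * ennreal (Gamma \<alpha> * x powr - \<alpha>) \<partial>lborel)"
  proof (rule nn_integral_cong)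
    fix u :: real
    have "(\<integral>\<^sup>+t. ?h t u \<partial>lborel) = ennreal \<bar>1\<bar> * (\<integral>\<^sup>+v. ?h (u + 1 * v) u \<partial>lborel)"
      by (rule nn_integral_real_affine) auto
    also have "\<dots> = (\<integral>\<^sup>+v. ennreal (indicator {0<..} u * (exp (- x * u) * ?k u)) * ennreal (indicator {0<..} v * (v powr (\<alpha> - 1) * exp (- x * v))) \<partial>lborel)"
      by (simp, intro nn_integral_cong)
         (auto simp: ennreal_mult[symmetric] exp_add[symmetric] algebra_simps split: split_indicator)
    also have "\<dots> = ennreal (indicator {0<..} u * (exp (- x * u) * ?k u)) * ennreal (Gamma \<alpha> * x powr - \<alpha>)"
      using nn_integral_exp_powr[OF assms(1,2)] by (subst nn_integral_cmult) simp_all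
    finally show "(\<integral>\<^sup>+t. ?h t u \<partial>lborel) = ennreal (indicator {0<..} u * (exp (- x * u) * ?k u)) * ennreal (Gamma \<alpha> * x powr - \<alpha>)" .
  qed
  also have "\<dots> = ennreal (Gamma (x + \<alpha>) * Gamma (1 - \<alpha>) / Gamma (x + 1)) * ennreal (Gamma \<alpha> * x powr - \<alpha>)"
    using nn_integral_exp_minus_1_powr[OF assms] by (subst nn_integral_multc) simp_all
  also have "\<dots> = ennreal (Gamma (x + \<alpha>) * Gamma (1 - \<alpha>) / Gamma (x + 1) * (Gamma \<alpha> * x powr - \<alpha>))"
    using assms by (intro ennreal_mult[symmetric]) (auto intro!: mult_nonneg_nonneg divide_nonneg_nonneg less_imp_le[OF Gamma_real_pos])
  also have "Gamma (x + \<alpha>) * Gamma (1 - \<alpha>) / Gamma (x + 1) * (Gamma \<alpha> * x powr - \<alpha>)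
      = Gamma \<alpha> * Gamma (1 - \<alpha>) * F_alpha \<alpha> x / x"
  proof -
    have "Gamma (x + 1) = x * Gamma x" using assms by (intro Gamma_plus1) (auto elim!: nonpos_Ints_cases)
    then show ?thesis by (simp add: F_alpha_def powr_minus divide_inverse)
  qed
  finally show ?thesis .
qed

lemma id_measurable_on_pos:
  fixes \<nu> :: "real measure"
  assumes "sets \<nu> = sets (restrict_space borel {0<..})"
  shows "(\<lambda>t. t) \<in> borel_measurable \<nu>"
  by (simp add: measurable_cong_sets[OF assms refl] measurable_restrict_space1)

lemma one_minus_exp_measurable:
  fixes \<nu> :: "real measure"
  assumes "sets \<nu> = sets (restrict_space borel {0<..})"
  shows "(\<lambda>t. 1 - exp (- x * t)) \<in> borel_measurable \<nu>"
  by (rule measurable_compose[OF id_measurable_on_pos[OF assms], of "\<lambda>t. 1 - exp (- x * t)"]) simp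

lemma space_on_pos:
  fixes \<nu> :: "real measure"
  assumes "sets \<nu> = sets (restrict_space borel {0<..})"
  shows "space \<nu> = {0<..}"
  using sets_eq_imp_space_eq[OF assms] by (simp add: space_restrict_space)

text \<open>Write \<open>1 - exp (- x * t)\<close> as the integral of \<open>x * exp (- x * s)\<close>
  over \<open>0 < s < t\<close> and exchange the integrals. The measure of \<open>{s<..}\<close> is
  \<open>J s\<close>, which leaves x times the Laplace transform of J.\<close>

lemma nn_integral_mu_alpha:
  assumes "0 < x" "0 < \<alpha>" "\<alpha> < 1"
  shows "(\<integral>\<^sup>+t. ennreal (1 - exp (- x * t)) \<partial>mu_alpha \<alpha>) = ennreal (Gamma \<alpha> * Gamma (1 - \<alpha>) * F_alpha \<alpha> x)"
proof -
  interpret M: finite_measure "mu_alpha \<alpha>" by (rule finite_measure_mu_alpha) fact+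
  interpret P: pair_sigma_finite "mu_alpha \<alpha>" lborel ..
  let ?h = "\<lambda>t s. ennreal (indicator {0<..} s * (indicator {0<..} (t - s) * (x * exp (- x * s))))"
  have [measurable]: "case_prod ?h \<in> borel_measurable (mu_alpha \<alpha> \<Otimes>\<^sub>M lborel)"
  proof -
    note id_measurable_on_pos[OF sets_mu_alpha, measurable]
    show ?thesis unfolding case_prod_unfold by measurable
  qed
  have "(\<integral>\<^sup>+t. ennreal (1 - exp (- x * t)) \<partial>mu_alpha \<alpha>) = (\<integral>\<^sup>+t. \<integral>\<^sup>+s. ?h t s \<partial>lborel \<partial>mu_alpha \<alpha>)"
  proof (rule nn_integral_cong)
    fix t assume "t \<in> space (mu_alpha \<alpha>)"
    then have t: "t > 0" by simp
    have "(\<integral>\<^sup>+s. ?h t s \<partial>lborel) = (\<integral>\<^sup>+s. ennreal (x * exp (- x * s)) * indicator {0..t} s \<partial>lborel)"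
      by (intro nn_integral_cong_AE eventually_mono[OF AE_conjI[OF AE_lborel_singleton[of 0] AE_lborel_singleton[of t]]])
         (auto split: split_indicator)
    also have "\<dots> = ennreal (- exp (- x * t) - - exp (- x * 0))"
      by (rule nn_integral_FTC_Icc) (use assms t in \<open>auto intro!: derivative_eq_intros\<close>)
    finally show "ennreal (1 - exp (- x * t)) = (\<integral>\<^sup>+s. ?h t s \<partial>lborel)" by simp
  qed
  also have "\<dots> = (\<integral>\<^sup>+s. \<integral>\<^sup>+t. ?h t s \<partial>mu_alpha \<alpha> \<partial>lborel)"
    by (rule P.Fubini'[symmetric]) measurable
  also have "\<dots> = (\<integral>\<^sup>+s. ennreal x * (ennreal (indicator {0<..} s * exp (- x * s)) * ennreal (J_ext \<alpha> s)) \<partial>lborel)"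
  proof (rule nn_integral_cong)
    fix s :: real
    show "(\<integral>\<^sup>+t. ?h t s \<partial>mu_alpha \<alpha>) = ennreal x * (ennreal (indicator {0<..} s * exp (- x * s)) * ennreal (J_ext \<alpha> s))"
    proof (cases "s > 0")
      case True
      have "(\<integral>\<^sup>+t. ?h t s \<partial>mu_alpha \<alpha>) = (\<integral>\<^sup>+t. ennreal (x * exp (- x * s)) * indicator {s<..} t \<partial>mu_alpha \<alpha>)"
        using True by (intro nn_integral_cong) (auto split: split_indicator)
      also have "\<dots> = ennreal (x * exp (- x * s)) * emeasure (mu_alpha \<alpha>) {s<..}"
        using True by (intro nn_integral_cmult_indicator) (auto simp: sets_mu_alpha sets_restrict_space_iff)
      finally show ?thesis using True assms
        by (simp add: emeasure_mu_alpha_Ioi ennreal_mult mult.assoc)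
    qed simp
  qed
  also have "\<dots> = ennreal x * (\<integral>\<^sup>+s. ennreal (indicator {0<..} s * exp (- x * s)) * ennreal (J_ext \<alpha> s) \<partial>lborel)"
  proof (rule nn_integral_cmult)
    have [measurable]: "J_ext \<alpha> \<in> borel_measurable borel"
      using isCont_J_ext[OF assms(2,3)]
      by (intro borel_measurable_continuous_onI) (simp add: continuous_on_eq_continuous_at)
    show "(\<lambda>s. ennreal (indicator {0<..} s * exp (- x * s)) * ennreal (J_ext \<alpha> s)) \<in> borel_measurable lborel"
      by measurable
  qed
  also have "\<dots> = ennreal (Gamma \<alpha> * Gamma (1 - \<alpha>) * F_alpha \<alpha> x)"
    using assms unfolding laplace_transform_J[OF assms]
    by (simp add: ennreal_mult'[symmetric])
  finally show ?thesis .
qed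

lemma F_alpha_nonneg:
  assumes "0 < x" "0 < \<alpha>"
  shows "F_alpha \<alpha> x \<ge> 0"
  using assms unfolding F_alpha_def
  by (auto intro!: divide_nonneg_nonneg mult_nonneg_nonneg less_imp_le[OF Gamma_real_pos])

lemma F_alpha_representation:
  assumes "0 < x" "0 < \<alpha>" "\<alpha> < 1"
  shows "(LINT t|mu_alpha \<alpha>. 1 - exp (- x * t)) = Gamma \<alpha> * Gamma (1 - \<alpha>) * F_alpha \<alpha> x"
proof -
  note id_measurable_on_pos[OF sets_mu_alpha, measurable]
  have "has_bochner_integral (mu_alpha \<alpha>) (\<lambda>t. 1 - exp (- x * t)) (Gamma \<alpha> * Gamma (1 - \<alpha>) * F_alpha \<alpha> x)"
  proof (rule has_bochner_integral_nn_integral)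
    show "0 \<le> Gamma \<alpha> * Gamma (1 - \<alpha>) * F_alpha \<alpha> x"
      using assms F_alpha_nonneg[of x \<alpha>] 
      by (auto intro!: mult_nonneg_nonneg less_imp_le[OF Gamma_real_pos])
    show "AE t in mu_alpha \<alpha>. 0 \<le> 1 - exp (- x * t)" using assms by (intro AE_I2) auto
  qed (use nn_integral_mu_alpha[OF assms] in auto)
  then show ?thesis by (simp add: has_bochner_integral_iff)
qed

section \<open>Bernstein functions from Laplace representations\<close>

text \<open>A tower of pointwise derivatives on an open set computes the iterated derivative there,
  whatever the function does outside the set.\<close>

lemma higher_deriv_eqI:
  fixes f :: "real \<Rightarrow> real"
  assumes "open S"
    and g0: "\<And>x. x \<in> S \<Longrightarrow> f x = g 0 x"
    and g: "\<And>n x. x \<in> S \<Longrightarrow> (g n has_field_derivative g (Suc n) x) (at x)"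
    and "x \<in> S"
  shows "(deriv ^^ n) f x = g n x"
    and "((deriv ^^ n) f has_field_derivative g (Suc n) x) (at x)"
proof -
  have eq: "\<forall>x\<in>S. (deriv ^^ n) f x = g n x" for n
  proof (induction n)
    case (Suc n)
    show ?case
    proof
      fix x assume x: "x \<in> S"
      have "((deriv ^^ n) f has_field_derivative g (Suc n) x) (at x)"
        by (rule has_field_derivative_transform_within_open[OF g[OF x] \<open>open S\<close> x]) (use Suc in auto)
      then show "(deriv ^^ Suc n) f x = g (Suc n) x" by (simp add: DERIV_imp_deriv)
    qed
  qed (use g0 in simp)
  then show "(deriv ^^ n) f x = g n x" using \<open>x \<in> S\<close> by blast
  show "((deriv ^^ n) f has_field_derivative g (Suc n) x) (at x)"
    by (rule has_field_derivative_transform_within_open[OF g[OF \<open>x \<in> S\<close>] \<open>open S\<close> \<open>x \<in> S\<close>]) (use eq in auto)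
qed

lemma power_times_exp_le:
  fixes x t :: real
  assumes "0 < x" "0 \<le> t"
  shows "t ^ n * exp (- x * t) \<le> fact n / x ^ n"
proof -
  have "(x * t) ^ n / fact n \<le> exp (x * t)"
  proof -
    have "(\<Sum>k\<in>{n}. (x * t) ^ k /\<^sub>R fact k) \<le> (\<Sum>k. (x * t) ^ k /\<^sub>R fact k)"
      by (rule sum_le_suminf[OF summable_exp_generic]) (use assms in auto)
    then show ?thesis by (simp add: exp_def divide_inverse mult.commute)
  qed
  then have "t ^ n * x ^ n \<le> fact n * exp (x * t)"
    by (simp add: field_simps power_mult_distrib)
  then show ?thesis using assms by (simp add: exp_minus divide_simps)
qed

lemma DERIV_quadratic_bound:
  fixes f :: "real \<Rightarrow> real"
  assumes "0 < \<delta>" and "\<And>h. \<bar>h\<bar> < \<delta> \<Longrightarrow> \<bar>f (x + h) - f x - h * D\<bar> \<le> K * h\<^sup>2"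
  shows "(f has_field_derivative D) (at x)"
proof -
  have "((\<lambda>h. (f (x + h) - f x) / h - D) \<longlongrightarrow> 0) (at 0)"
  proof (rule tendsto_0_le[of "\<lambda>h. h" _ _ K])
    have "eventually (\<lambda>h. h \<in> {-\<delta><..<\<delta>} \<and> h \<noteq> 0) (at (0::real))"
      using assms(1) by (intro eventually_conj eventually_at_in_open') (auto simp: eventually_at_filter)
    then show "eventually (\<lambda>h. norm ((f (x + h) - f x) / h - D) \<le> norm h * K) (at 0)"
    proof eventually_elim
      case (elim h)
      then have "\<bar>f (x + h) - f x - h * D\<bar> / \<bar>h\<bar> \<le> K * h\<^sup>2 / \<bar>h\<bar>"
        using assms(2)[of h] by (intro divide_right_mono) auto
      moreover have "K * h\<^sup>2 / \<bar>h\<bar> = \<bar>h\<bar> * K" using elim by (simp add: power2_eq_square abs_if)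
      moreover have "(f (x + h) - f x) / h - D = (f (x + h) - f x - h * D) / h"
        using elim by (simp add: field_simps)
      ultimately show ?case by (simp add: abs_divide)
    qed
  qed (rule tendsto_ident_at)
  then show ?thesis by (simp add: DERIV_def LIM_zero_iff)
qed

lemma exp_second_order_bound:
  fixes y :: real
  shows "\<bar>exp y - 1 - y\<bar> \<le> exp \<bar>y\<bar> * y\<^sup>2"
proof -
  obtain s where s: "\<bar>s\<bar> \<le> \<bar>y\<bar>" "exp y = (\<Sum>m<2. y ^ m / fact m) + exp s / fact 2 * y ^ 2"
    using Maclaurin_exp_le[of y 2] by blast
  then have "\<bar>exp y - 1 - y\<bar> = exp s / 2 * y\<^sup>2"
    by (simp add: lessThan_nat_numeral numeral_2_eq_2[symmetric])
  also have "\<dots> \<le> exp \<bar>y\<bar> * y\<^sup>2"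
  proof (rule mult_right_mono)
    have "exp s \<le> exp \<bar>y\<bar>" using s by simp
    then show "exp s / 2 \<le> exp \<bar>y\<bar>" using exp_gt_zero[of s] by linarith
  qed simp
  finally show ?thesis .
qed

lemma laplace_moment_integrable:
  fixes x :: real
  assumes "finite_measure M" "space M \<subseteq> {0<..}" "(\<lambda>t. t) \<in> borel_measurable M" "0 < x"
  shows "integrable M (\<lambda>t. t ^ n * exp (- x * t))"
proof (rule finite_measure.integrable_const_bound[OF assms(1)])
  note assms(3)[measurable]
  show "(\<lambda>t. t ^ n * exp (- x * t)) \<in> borel_measurable M" by measurable
  show "AE t in M. norm (t ^ n * exp (- x * t)) \<le> fact n / x ^ n"
    using assms power_times_exp_le[OF assms(4), of _ n] by (intro AE_I2) (auto simp: subset_eq less_imp_le)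
qed

text \<open>Differentiation under the integral. For \<open>\<bar>h\<bar> < x / 2\<close> the second-order
  Taylor remainder of the integrand is at most \<open>h\<^sup>2\<close> times
  \<open>t ^ (n + 2) * exp (- (x / 2) * t)\<close>, which is bounded in t and hence integrable over a
  finite measure.\<close>

lemma laplace_moment_has_derivative:
  fixes x :: real
  assumes "finite_measure M" "space M \<subseteq> {0<..}" "(\<lambda>t. t) \<in> borel_measurable M" "0 < x"
  shows "((\<lambda>x. LINT t|M. t ^ n * exp (- x * t)) has_field_derivative - (LINT t|M. t ^ Suc n * exp (- x * t))) (at x)"
proof (rule DERIV_quadratic_bound[where \<delta> = "x / 2" and K = "LINT t|M. t ^ (n + 2) * exp (- (x / 2) * t)"])
  note int = laplace_moment_integrable[OF assms(1-3)]
  fix h :: real assume h: "\<bar>h\<bar> < x / 2"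
  let ?d = "\<lambda>t. t ^ n * exp (- (x + h) * t) - t ^ n * exp (- x * t) - h * - (t ^ Suc n * exp (- x * t))"
  have xh: "x + h > 0" using h assms(4) by linarith
  have diff: "(LINT t|M. t ^ n * exp (- (x + h) * t)) - (LINT t|M. t ^ n * exp (- x * t)) 
      - h * - (LINT t|M. t ^ Suc n * exp (- x * t)) = (LINT t|M. ?d t)"
    using int[OF xh] int[OF assms(4)] by (simp del: power_Suc mult_minus_left)
  have "\<bar>LINT t|M. ?d t\<bar> \<le> (LINT t|M. h\<^sup>2 * (t ^ (n + 2) * exp (- (x / 2) * t)))"
  proof (rule integral_abs_bound_integral)
    show "integrable M ?d" 
      using int[OF xh] int[OF assms(4)] by (intro Bochner_Integration.integrable_diff integrable_mult_right integrable_minus)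
    show "integrable M (\<lambda>t. h\<^sup>2 * (t ^ (n + 2) * exp (- (x / 2) * t)))"
      by (intro integrable_mult_right int) (use assms in simp)
    fix t assume "t \<in> space M"
    then have t: "t > 0" using assms by auto
    have "?d t = t ^ n * exp (- x * t) * (exp (- h * t) - 1 - (- h * t))"
      by (simp add: algebra_simps exp_add[symmetric])
    also have "\<bar>\<dots>\<bar> \<le> t ^ n * exp (- x * t) * (exp \<bar>- h * t\<bar> * (- h * t)\<^sup>2)"
      using t exp_second_order_bound[of "- h * t"] by (simp add: abs_mult mult_left_mono del: mult_minus_left)
    also have "\<dots> = h\<^sup>2 * (t ^ (n + 2) * exp (- x * t + \<bar>h\<bar> * t))"
      using t by (simp only: exp_add) (simp add: abs_mult power2_eq_square power_add mult_ac)
    also have "\<dots> \<le> h\<^sup>2 * (t ^ (n + 2) * exp (- (x / 2) * t))"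
    proof -
      have "\<bar>h\<bar> * t \<le> (x / 2) * t" using h t by (intro mult_right_mono) auto
      then have "- x * t + \<bar>h\<bar> * t \<le> - (x / 2) * t" by linarith
      then have "exp (- x * t + \<bar>h\<bar> * t) \<le> exp (- (x / 2) * t)" by (simp only: exp_le_cancel_iff)
      then show ?thesis using t by (intro mult_left_mono) simp_all
    qed
    finally show "\<bar>?d t\<bar> \<le> h\<^sup>2 * (t ^ (n + 2) * exp (- (x / 2) * t))" .
  qed
  also have "\<dots> = (LINT t|M. t ^ (n + 2) * exp (- (x / 2) * t)) * h\<^sup>2"
    by (subst integral_mult_right_zero) (rule mult.commute)
  finally have "\<bar>LINT t|M. ?d t\<bar> \<le> (LINT t|M. t ^ (n + 2) * exp (- (x / 2) * t)) * h\<^sup>2" .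
  then show "\<bar>(LINT t|M. t ^ n * exp (- (x + h) * t)) - (LINT t|M. t ^ n * exp (- x * t)) 
      - h * - (LINT t|M. t ^ Suc n * exp (- x * t))\<bar> \<le> (LINT t|M. t ^ (n + 2) * exp (- (x / 2) * t)) * h\<^sup>2"
    by (subst diff)
qed (use assms in simp)

lemma bernstein_function_of_representation:
  fixes F :: "real \<Rightarrow> real"
  assumes "finite_measure M" "space M \<subseteq> {0<..}" "(\<lambda>t. t) \<in> borel_measurable M" "0 \<le> c"
    and F: "\<And>x. 0 < x \<Longrightarrow> F x = c * (LINT t|M. 1 - exp (- x * t))"
  shows "bernstein_function F"
proof -
  interpret finite_measure M by fact
  note int = laplace_moment_integrable[OF assms(1-3)]
  define L where "L n x = (LINT t|M. t ^ n * exp (- x * t))" for n :: nat and x :: real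
  have L: "(L n has_field_derivative - L (Suc n) x) (at x)" if "x > 0" for n x
    using laplace_moment_has_derivative[OF assms(1-3) that, of n] by (simp add: L_def[abs_def])
  have L_nonneg: "L n x \<ge> 0" for n x
    unfolding L_def using assms(2) by (intro Bochner_Integration.integral_nonneg) (auto simp: subset_eq less_imp_le)
  define g where "g n x = (if n = 0 then c * (measure M (space M) - L 0 x) else (-1) ^ Suc n * (c * L n x))" for n x
  have F0: "F x = g 0 x" if "x \<in> {0<..}" for x
    using that F[of x] int[of x 0] by (simp add: g_def L_def)
  have g_deriv: "(g n has_field_derivative g (Suc n) x) (at x)" if "x \<in> {0<..}" for n x
    using that unfolding g_def
    by (cases n) (auto intro!: derivative_eq_intros L)
  have D: "(deriv ^^ n) F x = g n x" "((deriv ^^ n) F has_field_derivative g (Suc n) x) (at x)" if "x > 0" for n x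
    using that higher_deriv_eqI[OF open_greaterThan F0 g_deriv] by auto
  have shift: "(deriv ^^ n) (deriv F) = (deriv ^^ Suc n) F" for n
    by (simp add: funpow_swap1)
  have smooth: "(deriv ^^ n) F differentiable (at x)" if "x > 0" for n x
    using D(2)[OF that, of n] real_differentiable_def by blast
  have "0 \<le> F x" if "x > 0" for x
    unfolding F[OF that] using assms that
    by (intro mult_nonneg_nonneg Bochner_Integration.integral_nonneg) (auto simp: subset_eq less_imp_le)
  moreover have "(-1) ^ n * (deriv ^^ Suc n) F x \<ge> 0" if "x > 0" for n x
  proof -
    have "(-1) ^ n * (deriv ^^ Suc n) F x = ((-1) ^ n * (-1) ^ n) * (c * L (Suc n) x)"
      unfolding D(1)[OF that] by (simp add: g_def mult_ac)
    also have "(-1) ^ n * (-1) ^ n = (1::real)" by (simp add: power_mult_distrib[symmetric])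
    finally show ?thesis using L_nonneg assms(4) by simp
  qed
  ultimately show ?thesis
    unfolding bernstein_function_def completely_monotone_def smooth_on_pos_def shift
    using smooth by blast
qed

section \<open>Uniqueness of the Levy measure of a bounded Bernstein function\<close>

text \<open>The Hausdorff moment problem is determinate: polynomials are uniformly dense in the
  continuous functions on \<open>[0, 1]\<close>.\<close>

lemma moments_determine_continuous_integrals:
  fixes f :: "'a \<Rightarrow> real" and \<phi> :: "real \<Rightarrow> real"
  assumes "finite_measure M" "finite_measure N"
    and f: "f \<in> borel_measurable M" "f \<in> borel_measurable N"
    and range: "\<And>x. x \<in> space M \<union> space N \<Longrightarrow> f x \<in> {0..1}"
    and moments: "\<And>n. (LINT x|M. f x ^ n) = (LINT x|N. f x ^ n)"
    and cont: "continuous_on UNIV \<phi>"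
  shows "(LINT x|M. \<phi> (f x)) = (LINT x|N. \<phi> (f x))"
proof -
  interpret M: finite_measure M by fact
  interpret N: finite_measure N by fact
  note f[measurable]
  have [measurable]: "\<phi> \<in> borel_measurable borel"
    by (rule borel_measurable_continuous_onI[OF cont])
  obtain B where B: "\<And>w. w \<in> {0..1} \<Longrightarrow> \<bar>\<phi> w\<bar> \<le> B"
    using compact_imp_bounded[OF compact_continuous_image[OF continuous_on_subset[OF cont subset_UNIV] compact_Icc]]
    by (force simp: bounded_iff)
  have int\<phi>: "integrable M (\<lambda>x. \<phi> (f x))" "integrable N (\<lambda>x. \<phi> (f x))"
    by (rule M.integrable_const_bound[where B=B] N.integrable_const_bound[where B=B];
        use range in \<open>auto intro!: AE_I2 B\<close>)+
  have intp: "integrable M (\<lambda>x. f x ^ n)" "integrable N (\<lambda>x. f x ^ n)" for n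
    by (rule M.integrable_const_bound[where B=1] N.integrable_const_bound[where B=1];
        use range in \<open>auto intro!: AE_I2 power_le_one\<close>)+
  define T where "T = measure M (space M) + measure N (space N)"
  have T: "T \<ge> 0" by (simp add: T_def)
  have small: "\<bar>(LINT x|M. \<phi> (f x)) - (LINT x|N. \<phi> (f x))\<bar> \<le> e * T" if "e > 0" for e
  proof -
    obtain p where p: "real_polynomial_function p" "\<And>w. w \<in> {0..1} \<Longrightarrow> \<bar>\<phi> w - p w\<bar> < e"
      using Stone_Weierstrass_real_polynomial_function[OF compact_Icc continuous_on_subset[OF cont subset_UNIV] \<open>e > 0\<close>]
      by metis
    obtain a n where pa: "p = (\<lambda>w. \<Sum>i\<le>n. a i * w ^ i)"
      using p(1) by (auto simp: real_polynomial_function_iff_sum)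
    have ip: "integrable M (\<lambda>x. p (f x))" "integrable N (\<lambda>x. p (f x))"
      unfolding pa by (intro Bochner_Integration.integrable_sum integrable_mult_right intp)+
    have eq: "(LINT x|M. p (f x)) = (LINT x|N. p (f x))"
      unfolding pa by (simp add: Bochner_Integration.integral_sum intp moments)
    have "\<bar>LINT x|M. \<phi> (f x) - p (f x)\<bar> \<le> (LINT x|M. e)"
      by (rule order_trans[OF integral_abs_bound integral_mono]) (use range p(2) int\<phi> ip in \<open>auto intro: less_imp_le\<close>)
    moreover have "\<bar>LINT x|N. \<phi> (f x) - p (f x)\<bar> \<le> (LINT x|N. e)"
      by (rule order_trans[OF integral_abs_bound integral_mono]) (use range p(2) int\<phi> ip in \<open>auto intro: less_imp_le\<close>)
    ultimately show ?thesis using int\<phi> ip eq by (simp add: T_def algebra_simps)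
  qed
  show ?thesis
  proof (rule ccontr)
    assume "\<not> ?thesis"
    then have d: "\<bar>(LINT x|M. \<phi> (f x)) - (LINT x|N. \<phi> (f x))\<bar> > 0" (is "?d > 0") by simp
    \<comment> \<open>The error bound with \<open>e = ?d / (T + 1)\<close> makes the difference smaller
      than itself; T may be 0, hence the summand 1.\<close>
    then have "?d / (T + 1) > 0" using T by simp
    from small[OF this] have "?d * (T + 1) \<le> ?d * T" using T by (simp add: field_simps)
    then show False using d by (simp add: algebra_simps)
  qed
qed

text \<open>The indicator of \<open>{c..}\<close> is the pointwise limit of the continuous functions that
  vanish up to \<open>c - 1 / k\<close>, equal 1 from c on and are affine in between.\<close>

lemma moments_determine_tails:
  fixes f :: "'a \<Rightarrow> real"
  assumes "finite_measure M" "finite_measure N"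
    and f: "f \<in> borel_measurable M" "f \<in> borel_measurable N"
    and range: "\<And>x. x \<in> space M \<union> space N \<Longrightarrow> f x \<in> {0..1}"
    and moments: "\<And>n. (LINT x|M. f x ^ n) = (LINT x|N. f x ^ n)"
  shows "measure M {x \<in> space M. c \<le> f x} = measure N {x \<in> space N. c \<le> f x}"
proof -
  define \<phi> where "\<phi> k w = max 0 (min 1 (1 + real k * (w - c)))" for k w
  have lim: "(\<lambda>k. \<phi> k w) \<longlonglongrightarrow> indicator {c..} w" for w
  proof (cases "c \<le> w")
    case True
    then have "\<phi> k w = 1" for k by (simp add: \<phi>_def)
    then show ?thesis using True by simp
  next
    case False
    obtain k0 where k0: "1 / (c - w) \<le> real k0" using real_arch_simple by blast
    have "\<phi> k w = 0" if "k \<ge> k0" for k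
    proof -
      have "1 / (c - w) \<le> real k" using k0 that by linarith
      then have "1 \<le> real k * (c - w)" using False by (simp add: divide_simps)
      then show ?thesis by (simp add: \<phi>_def algebra_simps)
    qed
    then have "eventually (\<lambda>k. \<phi> k w = 0) sequentially" by (auto simp: eventually_sequentially)
    then show ?thesis using False by (simp add: tendsto_eventually)
  qed
  have conv: "(\<lambda>k. LINT x|K. \<phi> k (f x)) \<longlonglongrightarrow> measure K {x \<in> space K. c \<le> f x}"
    if "finite_measure K" and [measurable]: "f \<in> borel_measurable K" for K
  proof -
    interpret K: finite_measure K by fact
    have "(\<lambda>k. LINT x|K. \<phi> k (f x)) \<longlonglongrightarrow> (LINT x|K. indicator {c..} (f x))"
    proof (rule integral_dominated_convergence[where w="\<lambda>_. 1"])
      show "(\<lambda>x. \<phi> k (f x)) \<in> borel_measurable K" for k unfolding \<phi>_def by measurable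
      show "AE x in K. norm (\<phi> k (f x)) \<le> 1" for k by (intro AE_I2) (simp add: \<phi>_def)
    qed (use lim in auto)
    also have "(LINT x|K. indicator {c..} (f x)) = (LINT x|K. indicator {x \<in> space K. c \<le> f x} x)"
      by (intro Bochner_Integration.integral_cong) (auto split: split_indicator)
    also have "\<dots> = measure K {x \<in> space K. c \<le> f x}"
      by (auto intro!: arg_cong[where f = "measure K"])
    finally show ?thesis .
  qed
  have "(LINT x|M. \<phi> k (f x)) = (LINT x|N. \<phi> k (f x))" for k
    by (rule moments_determine_continuous_integrals[OF assms])
       (auto simp: \<phi>_def intro!: continuous_intros)
  then show ?thesis
    using conv[OF assms(1) f(1)] conv[OF assms(2) f(2)] by (simp add: LIMSEQ_unique)
qed

lemma one_minus_exp_tendsto_1: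
  fixes t :: real
  assumes "0 < t"
  shows "(\<lambda>n. 1 - exp (- real (Suc n) * t)) \<longlonglongrightarrow> 1"
proof -
  have "filterlim (\<lambda>n. t * real (Suc n)) at_top sequentially"
    by (intro filterlim_tendsto_pos_mult_at_top[OF tendsto_const assms] 
          filterlim_compose[OF filterlim_real_sequentially filterlim_Suc])
  then have "(\<lambda>n. exp (- (t * real (Suc n)))) \<longlonglongrightarrow> 0"
    by (intro filterlim_compose[OF exp_at_bot] filterlim_compose[OF filterlim_uminus_at_bot_at_top])
  then have "(\<lambda>n. 1 - exp (- (t * real (Suc n)))) \<longlonglongrightarrow> 1 - 0"
    by (intro tendsto_intros)
  then show ?thesis by (simp add: mult.commute del: of_nat_Suc)
qed

lemma integral_one_minus_exp_tendsto:
  fixes \<nu> :: "real measure"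
  assumes "finite_measure \<nu>" and sets: "sets \<nu> = sets (restrict_space borel {0<..})"
  shows "(\<lambda>n. LINT t|\<nu>. 1 - exp (- (1 / real (Suc n)) * t)) \<longlonglongrightarrow> 0"
    and "(\<lambda>n. LINT t|\<nu>. 1 - exp (- real (Suc n) * t)) \<longlonglongrightarrow> measure \<nu> (space \<nu>)"
proof -
  interpret finite_measure \<nu> by fact
 have "(\<lambda>n. LINT t|\<nu>. 1 - exp (- (1 / real (Suc n)) * t)) \<longlonglongrightarrow> (LINT t|\<nu>. 0)"
  proof (rule integral_dominated_convergence[where w="\<lambda>_. 1"])
    show "AE t in \<nu>. (\<lambda>n. 1 - exp (- (1 / real (Suc n)) * t)) \<longlonglongrightarrow> 0"
    proof (rule AE_I2)
      fix t :: real
      have "(\<lambda>n. 1 - exp (- (1 / real (Suc n)) * t)) \<longlonglongrightarrow> 1 - exp (- 0 * t)"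
        by (intro tendsto_intros LIMSEQ_Suc[OF lim_1_over_n])
      then show "(\<lambda>n. 1 - exp (- (1 / real (Suc n)) * t)) \<longlonglongrightarrow> 0" by simp
    qed
    show "AE t in \<nu>. norm (1 - exp (- (1 / real (Suc n)) * t)) \<le> 1" for n
      by (rule AE_I2) (auto simp: space_on_pos[OF sets])
  qed (rule one_minus_exp_measurable[OF sets] | simp)+
  then show "(\<lambda>n. LINT t|\<nu>. 1 - exp (- (1 / real (Suc n)) * t)) \<longlonglongrightarrow> 0" by simp
  have "(\<lambda>n. LINT t|\<nu>. 1 - exp (- real (Suc n) * t)) \<longlonglongrightarrow> (LINT t|\<nu>. 1)"
  proof (rule integral_dominated_convergence[where w="\<lambda>_. 1"])
    show "AE t in \<nu>. (\<lambda>n. 1 - exp (- real (Suc n) * t)) \<longlonglongrightarrow> 1"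
      by (rule AE_I2) (rule one_minus_exp_tendsto_1, simp add: space_on_pos[OF sets])
    show "AE t in \<nu>. norm (1 - exp (- real (Suc n) * t)) \<le> 1" for n
      by (rule AE_I2) (simp add: space_on_pos[OF sets] del: of_nat_Suc)
  qed (rule one_minus_exp_measurable[OF sets] | simp)+
  then show "(\<lambda>n. LINT t|\<nu>. 1 - exp (- real (Suc n) * t)) \<longlonglongrightarrow> measure \<nu> (space \<nu>)" by simp
qed

lemma levy_triple_integrable:
  assumes "levy_triple g a b \<nu>" "0 < x"
  shows "integrable \<nu> (\<lambda>t. 1 - exp (- x * t))"
proof (rule Bochner_Integration.integrable_bound)
  have sets: "sets \<nu> = sets (restrict_space borel {0<..})" using assms by (simp add: levy_triple_def)
  note id_measurable_on_pos[OF sets, measurable]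
  have nn: "(\<integral>\<^sup>+t. ennreal (norm (min 1 t)) \<partial>\<nu>) = (\<integral>\<^sup>+t. ennreal (min 1 t) \<partial>\<nu>)"
    by (intro nn_integral_cong) (auto simp: space_on_pos[OF sets])
  have "integrable \<nu> (\<lambda>t. min 1 t)"
    by (rule integrableI_bounded) (use assms nn in \<open>simp_all add: levy_triple_def\<close>)
  then show "integrable \<nu> (\<lambda>t. max 1 x * min 1 t)" by simp
  show "(\<lambda>t. 1 - exp (- x * t)) \<in> borel_measurable \<nu>" by (rule one_minus_exp_measurable[OF sets])
  show "AE t in \<nu>. norm (1 - exp (- x * t)) \<le> norm (max 1 x * min 1 t)"
  proof (rule AE_I2)
    fix t assume "t \<in> space \<nu>"
    then have t: "t > 0" by (simp add: space_on_pos[OF sets])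
    have "1 - exp (- x * t) \<le> x * t" using exp_ge_add_one_self[of "- x * t"] by simp
    moreover have "x * t \<le> max 1 x * t" using t by (intro mult_right_mono) auto
    moreover have "1 - exp (- x * t) \<le> 1" "1 \<le> max 1 x" by auto
    ultimately have "1 - exp (- x * t) \<le> max 1 x * t" "1 - exp (- x * t) \<le> max 1 x" by linarith+
    then have "1 - exp (- x * t) \<le> max 1 x * min 1 t"
      by (cases "t \<le> 1") (simp_all add: min_def)
    moreover have "0 \<le> 1 - exp (- x * t)" using assms t by simp
    ultimately show "norm (1 - exp (- x * t)) \<le> norm (max 1 x * min 1 t)" by simp
  qed
qed

text \<open>The integrals of \<open>1 - exp (- n * t)\<close> are at most K and increase to the total
  mass.\<close>

lemma levy_measure_finite_if_bounded:
  assumes levy: "levy_triple g a b \<nu>" and bound: "\<And>x. 0 < x \<Longrightarrow> g x \<le> K"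
  shows "finite_measure \<nu>"
proof -
  have sets: "sets \<nu> = sets (restrict_space borel {0<..})" and ab: "a \<ge> 0" "b \<ge> 0"
    and g: "\<And>x. 0 < x \<Longrightarrow> g x = a + b * x + (LINT t|\<nu>. 1 - exp (- x * t))"
    using levy by (auto simp: levy_triple_def)
  note id_measurable_on_pos[OF sets, measurable]
  \<comment> \<open>The truncation \<open>max 0 t\<close> makes the sequence increasing at every real
    t, not only on the space of the measure.\<close>
  let ?f = "\<lambda>n t. ennreal (1 - exp (- real (Suc n) * max 0 t))"
  have "(\<lambda>n. \<integral>\<^sup>+t. ?f n t \<partial>\<nu>) \<longlonglongrightarrow> (\<integral>\<^sup>+t. ennreal (indicator {0<..} t) \<partial>\<nu>)"
  proof (rule nn_integral_LIMSEQ)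
    show "incseq ?f"
      by (auto simp: incseq_def le_fun_def intro!: ennreal_leI mult_right_mono)
    show "?f n \<in> borel_measurable \<nu>" for n by measurable
    show "(\<lambda>n. ?f n t) \<longlonglongrightarrow> ennreal (indicator {0<..} t)" for t :: real
    proof (cases "t > 0")
      case True
      then have "(\<lambda>n. 1 - exp (- real (Suc n) * t)) \<longlonglongrightarrow> 1" by (rule one_minus_exp_tendsto_1)
      then have "(\<lambda>n. ennreal (1 - exp (- real (Suc n) * t))) \<longlonglongrightarrow> ennreal 1" by (rule tendsto_ennrealI)
      then show ?thesis using True by simp
    qed simp
  qed
  moreover have "(\<integral>\<^sup>+t. ?f n t \<partial>\<nu>) \<le> ennreal K" for n
  proof -
    let ?x = "real (Suc n)"
    have "(\<integral>\<^sup>+t. ?f n t \<partial>\<nu>) = (\<integral>\<^sup>+t. ennreal (1 - exp (- ?x * t)) \<partial>\<nu>)"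
      by (intro nn_integral_cong) (simp add: space_on_pos[OF sets])
    also have "\<dots> = ennreal (LINT t|\<nu>. 1 - exp (- ?x * t))"
      by (rule nn_integral_eq_integral[OF levy_triple_integrable[OF levy]])
         (auto intro!: AE_I2 simp: space_on_pos[OF sets] simp del: of_nat_Suc)
    also have "(LINT t|\<nu>. 1 - exp (- ?x * t)) \<le> K"
    proof -
      have "0 \<le> b * ?x" using ab by (intro mult_nonneg_nonneg) auto
      then show ?thesis using g[of ?x, OF of_nat_0_less_iff[THEN iffD2]] bound[of ?x, OF of_nat_0_less_iff[THEN iffD2]] ab by linarith
    qed
    finally show ?thesis by (simp add: ennreal_leI)
  qed
  ultimately have "(\<integral>\<^sup>+t. ennreal (indicator {0<..} t) \<partial>\<nu>) \<le> ennreal K"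
    by (intro LIMSEQ_le_const2) auto
  moreover have "(\<integral>\<^sup>+t. ennreal (indicator {0<..} t) \<partial>\<nu>) = emeasure \<nu> (space \<nu>)"
  proof -
    have "(\<integral>\<^sup>+t. ennreal (indicator {0<..} t) \<partial>\<nu>) = (\<integral>\<^sup>+t. 1 \<partial>\<nu>)"
      by (intro nn_integral_cong) (simp add: space_on_pos[OF sets])
    then show ?thesis by simp
  qed
  ultimately show ?thesis
    by (intro finite_measureI) (auto simp: top_unique)
qed

text \<open>A bounded function leaves no room for a drift b. Letting x tend to 0 gives
  \<open>a = 0\<close>, letting x tend to infinity gives equality of the total masses, and the integer
  values of x give equality of all moments of \<open>exp (- t)\<close>.\<close>

lemma bounded_levy_triple_unique:
  assumes levy: "levy_triple g a b \<nu>" and levy0: "levy_triple g 0 0 \<nu>\<^sub>0"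
    and fin0: "finite_measure \<nu>\<^sub>0"
  shows "finite_measure \<nu>" and "measure \<nu> {0<..s} = measure \<nu>\<^sub>0 {0<..s}"
proof -
  interpret N0: finite_measure \<nu>\<^sub>0 by fact
  have sets: "sets \<nu> = sets (restrict_space borel {0<..})" and ab: "a \<ge> 0" "b \<ge> 0"
    and g: "\<And>x. 0 < x \<Longrightarrow> g x = a + b * x + (LINT t|\<nu>. 1 - exp (- x * t))"
    using levy by (auto simp: levy_triple_def)
  have sets0: "sets \<nu>\<^sub>0 = sets (restrict_space borel {0<..})"
    and g0: "\<And>x. 0 < x \<Longrightarrow> g x = (LINT t|\<nu>\<^sub>0. 1 - exp (- x * t))"
    using levy0 by (auto simp: levy_triple_def)
  note [measurable] = id_measurable_on_pos[OF sets] id_measurable_on_pos[OF sets0]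
  define K where "K = measure \<nu>\<^sub>0 (space \<nu>\<^sub>0)"
  have gK: "g x \<le> K" if "0 < x" for x
  proof -
    have "(LINT t|\<nu>\<^sub>0. 1 - exp (- x * t)) \<le> (LINT t|\<nu>\<^sub>0. 1)"
      by (rule integral_mono[OF levy_triple_integrable[OF levy0 that]]) auto
    then show ?thesis using g0[OF that] by (simp add: K_def)
  qed
  show fin: "finite_measure \<nu>" by (rule levy_measure_finite_if_bounded[OF levy gK])
  interpret N: finite_measure \<nu> by fact
  have nonneg: "0 \<le> (LINT t|\<nu>. 1 - exp (- x * t))" if "0 < x" for x
    using that by (intro Bochner_Integration.integral_nonneg) (simp add: space_on_pos[OF sets])
  have "b = 0"
  proof (rule ccontr)
    assume "b \<noteq> 0"
    then have b: "b > 0" using ab by simp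
    \<comment> \<open>At this point the drift alone exceeds the bound K.\<close>
    define x where "x = (\<bar>K\<bar> + 1) / b"
    have x: "x > 0" "b * x = \<bar>K\<bar> + 1" using b by (auto simp: x_def intro!: divide_pos_pos)
    then show False using g[OF x(1)] gK[OF x(1)] nonneg[OF x(1)] ab by linarith
  qed
  have "a = 0"
  proof -
    have "(\<lambda>n. a + (LINT t|\<nu>. 1 - exp (- (1 / real (Suc n)) * t))) \<longlonglongrightarrow> a + 0"
      by (intro tendsto_intros integral_one_minus_exp_tendsto[OF fin sets])
    moreover have "a + (LINT t|\<nu>. 1 - exp (- (1 / real (Suc n)) * t)) = (LINT t|\<nu>\<^sub>0. 1 - exp (- (1 / real (Suc n)) * t))" for n
      using g[of "1 / real (Suc n)"] g0[of "1 / real (Suc n)"] by (simp add: \<open>b = 0\<close> del: of_nat_Suc)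
    ultimately have "(\<lambda>n. LINT t|\<nu>\<^sub>0. 1 - exp (- (1 / real (Suc n)) * t)) \<longlonglongrightarrow> a"
      by (simp del: of_nat_Suc)
    from LIMSEQ_unique[OF this integral_one_minus_exp_tendsto(1)[OF fin0 sets0]] show ?thesis .
  qed
  have same: "(LINT t|\<nu>. 1 - exp (- x * t)) = (LINT t|\<nu>\<^sub>0. 1 - exp (- x * t))" if "0 < x" for x
    using g[OF that] g0[OF that] \<open>a = 0\<close> \<open>b = 0\<close> by simp
  have mass: "measure \<nu> (space \<nu>) = measure \<nu>\<^sub>0 (space \<nu>\<^sub>0)"
  proof (rule LIMSEQ_unique[OF integral_one_minus_exp_tendsto(2)[OF fin sets]])
    have "(LINT t|\<nu>. 1 - exp (- real (Suc n) * t)) = (LINT t|\<nu>\<^sub>0. 1 - exp (- real (Suc n) * t))" for n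
      by (rule same) simp
    then show "(\<lambda>n. LINT t|\<nu>. 1 - exp (- real (Suc n) * t)) \<longlonglongrightarrow> measure \<nu>\<^sub>0 (space \<nu>\<^sub>0)"
      using integral_one_minus_exp_tendsto(2)[OF fin0 sets0] by (simp only:)
  qed
  have moments: "(LINT t|\<nu>. exp (- t) ^ n) = (LINT t|\<nu>\<^sub>0. exp (- t) ^ n)" for n
  proof (cases "n = 0")
    case False
    then have n: "real n > 0" by simp
    have "(LINT t|\<nu>. 1 - (1 - exp (- real n * t))) = (LINT t|\<nu>\<^sub>0. 1 - (1 - exp (- real n * t)))"
      using levy_triple_integrable[OF levy n] levy_triple_integrable[OF levy0 n] same[OF n] mass
      by (subst (1 2) Bochner_Integration.integral_diff) (auto simp del: mult_minus_left)
    then show ?thesis by (simp add: exp_of_nat_mult[symmetric])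
  qed (use mass in simp)
  have "measure \<nu> {t \<in> space \<nu>. exp (- s) \<le> exp (- t)} = measure \<nu>\<^sub>0 {t \<in> space \<nu>\<^sub>0. exp (- s) \<le> exp (- t)}"
    by (rule moments_determine_tails[OF fin fin0 _ _ _ moments])
       (auto simp: space_on_pos[OF sets] space_on_pos[OF sets0])
  moreover have "{t. 0 < t \<and> t \<le> s} = {0<..s}" by auto
  ultimately show "measure \<nu> {0<..s} = measure \<nu>\<^sub>0 {0<..s}"
    by (simp add: space_on_pos[OF sets] space_on_pos[OF sets0])
qed

section \<open>The Levy measure has no completely monotone density\<close>

text \<open>On \<open>{x / 2..}\<close> the function J is a constant minus the integral of
  \<open>m / c\<close>, and m is continuous, so the fundamental theorem of calculus applies.\<close>

lemma J_ext_deriv_of_density: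
  assumes "0 < \<alpha>" "\<alpha> < 1" "0 < c"
    and fin: "finite_measure \<nu>"
    and meas: "\<And>s. 0 < s \<Longrightarrow> measure \<nu> {0<..s} = c * (J_ext \<alpha> 0 - J_ext \<alpha> s)"
    and cont: "continuous_on {0<..} m" and m_nonneg: "\<And>x. 0 < x \<Longrightarrow> 0 \<le> m x"
    and dens: "\<nu> = density (restrict_space lborel {0<..}) (\<lambda>t. ennreal (m t))"
    and "0 < x"
  shows "(J_ext \<alpha> has_field_derivative - (m x / c)) (at x)"
proof -
  interpret finite_measure \<nu> by fact
  have sets: "sets \<nu> = sets (restrict_space borel {0<..})"
    unfolding dens sets_density by (intro sets_restrict_space_cong) simp
  have diff: "J_ext \<alpha> t = J_ext \<alpha> s - integral {s..t} m / c" if st: "0 < s" "s \<le> t" for s t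
  proof -
    have cont_st: "continuous_on {s..t} m" by (rule continuous_on_subset[OF cont]) (use st in auto)
    have mset: "{s<..t} \<in> sets \<nu>" "{0<..s} \<in> sets \<nu>" "{0<..t} \<in> sets \<nu>"
      unfolding sets using st by (auto simp: sets_restrict_space_iff)
    have "measure \<nu> {0<..t} = measure \<nu> {0<..s} + measure \<nu> {s<..t}"
    proof -
      have "{0<..t} = {0<..s} \<union> {s<..t}" using st by auto
      then show ?thesis using mset by (simp add: finite_measure_Union disjoint_iff)
    qed
    then have "measure \<nu> {s<..t} = c * (J_ext \<alpha> s - J_ext \<alpha> t)"
      using meas[of s] meas[of t] st by (simp add: algebra_simps)
    moreover have "measure \<nu> {s<..t} = integral {s..t} m"
    proof -
      have "m \<in> borel_measurable (restrict_space borel {0<..})"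
        by (rule borel_measurable_continuous_on_restrict[OF cont])
      also have "borel_measurable (restrict_space borel {0<..}) = borel_measurable (restrict_space lborel {0<..})"
        by (intro measurable_cong_sets sets_restrict_space_cong) simp_all
      finally have m_meas: "m \<in> borel_measurable (restrict_space lborel {0<..})" .
      have mset': "{s<..t} \<in> sets (restrict_space lborel {0<..})"
        using st by (subst sets_restrict_space_iff) auto
      have "emeasure \<nu> {s<..t} = (\<integral>\<^sup>+u. ennreal (m u) * indicator {s<..t} u \<partial>restrict_space lborel {0<..})"
        unfolding dens by (rule emeasure_density[OF measurable_compose[OF m_meas measurable_ennreal] mset'])
      also have "\<dots> = (\<integral>\<^sup>+u. ennreal (m u) * indicator {s<..t} u * indicator {0<..} u \<partial>lborel)"
        by (rule nn_integral_restrict_space) simp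
      also have "\<dots> = (\<integral>\<^sup>+u. ennreal (m u) * indicator {s..t} u \<partial>lborel)"
        by (intro nn_integral_cong_AE eventually_mono[OF AE_lborel_singleton[of s]])
           (use st in \<open>auto split: split_indicator\<close>)
      also have "\<dots> = ennreal (integral {s..t} m)"
        by (rule nn_integral_has_integral_lebesgue')
           (use st m_nonneg in \<open>auto intro!: integrable_integral integrable_continuous_real cont_st\<close>)
      finally have "emeasure \<nu> {s<..t} = ennreal (integral {s..t} m)" .
      moreover have "0 \<le> integral {s..t} m"
        by (rule integral_nonneg[OF integrable_continuous_real[OF cont_st]]) (use st m_nonneg in auto)
      ultimately show ?thesis by (simp add: measure_def)
    qed
    ultimately show ?thesis using \<open>0 < c\<close> by (simp add: field_simps)
  qed
  have "((\<lambda>t. integral {x / 2..t} m) has_field_derivative m x) (at x within {x / 2..x + 1})"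
    by (rule integral_has_real_derivative)
       (use \<open>0 < x\<close> in \<open>auto intro: continuous_on_subset[OF cont]\<close>)
  then have "((\<lambda>t. integral {x / 2..t} m) has_field_derivative m x) (at x)"
    using \<open>0 < x\<close> by (simp add: at_within_Icc_at)
  then have "((\<lambda>t. J_ext \<alpha> (x / 2) - integral {x / 2..t} m / c) has_field_derivative - (m x / c)) (at x)"
    using \<open>0 < c\<close> by (auto intro!: derivative_eq_intros)
  then show ?thesis
    by (rule has_field_derivative_transform_within_open[where S = "{x / 2<..}"])
       (use \<open>0 < x\<close> in \<open>auto intro!: diff[symmetric]\<close>)
qed

text \<open>Integrate the Taylor series of the Todd factor at \<open>- (t * s)\<close> term by term
  against the weight. The n-th moment of the weight is a Beta value, bounded uniformly in n, which
  justifies the exchange inside the radius of convergence.\<close>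

lemma J_ext_power_series:
  assumes "0 < \<alpha>" "\<alpha> < 1" "0 \<le> t" "t < 2 * pi"
    and r: "\<And>x. \<bar>x\<bar> < 2 * pi \<Longrightarrow> (\<lambda>n. r n * x ^ n) sums todd_powr \<alpha> x"
  shows "(\<lambda>n. (-1) ^ n * r n * Beta (real n + 1 - \<alpha>) \<alpha> * t ^ n) sums J_ext \<alpha> t"
proof -
  let ?f = "\<lambda>n s. r n * (- t) ^ n * (beta_weight \<alpha> s * s ^ n)"
  have bw: "integrable lborel (\<lambda>s. beta_weight \<alpha> s * s ^ n)"
      "(LINT s|lborel. beta_weight \<alpha> s * s ^ n) = Beta (real n + 1 - \<alpha>) \<alpha>" for n
    using beta_weight_moment[OF assms(1,2), of n] by (auto simp: has_bochner_integral_iff)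
  have abs_r: "summable (\<lambda>n. \<bar>r n\<bar> * t ^ n)"
  proof -
    obtain y where y: "t < y" "y < 2 * pi" using dense[OF assms(4)] by blast
    have "summable (\<lambda>n. r n * y ^ n)" by (rule sums_summable[OF r]) (use y assms in auto)
    then have "summable (\<lambda>n. norm (r n * t ^ n))"
      by (rule powser_insidea) (use y assms in auto)
    then show ?thesis using assms by (simp add: abs_mult)
  qed
  have norm_f: "norm (?f n s) = \<bar>r n\<bar> * t ^ n * (beta_weight \<alpha> s * s ^ n)" for n s
    using assms by (cases "s > 0") (auto simp: abs_mult power_abs beta_weight_nonneg beta_weight_def)
  have sums_f: "(\<lambda>n. ?f n s) sums (beta_weight \<alpha> s * todd_powr \<alpha> (- (t * s)))" for s
  proof (cases "s \<in> {0<..<1}")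
    case True
    then have "t * s \<le> t * 1" using assms by (intro mult_left_mono) auto
    then have "\<bar>- (t * s)\<bar> < 2 * pi" using True assms by simp
    then have "(\<lambda>n. beta_weight \<alpha> s * (r n * (- (t * s)) ^ n)) sums (beta_weight \<alpha> s * todd_powr \<alpha> (- (t * s)))"
      by (intro sums_mult r)
    moreover have "(- (t * s)) ^ n = (- t) ^ n * s ^ n" for n
      by (simp only: minus_mult_left power_mult_distrib)
    ultimately show ?thesis by (simp only: mult_ac)
  qed (simp add: beta_weight_def)
  have beta_le: "Beta (real n + 1 - \<alpha>) \<alpha> \<le> Beta (1 - \<alpha>) \<alpha>" for n
  proof -
    have "(LINT s|lborel. beta_weight \<alpha> s * s ^ n) \<le> (LINT s|lborel. beta_weight \<alpha> s * s ^ 0)"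
    proof (rule integral_mono[OF bw(1) bw(1)])
      fix s :: real
      show "beta_weight \<alpha> s * s ^ n \<le> beta_weight \<alpha> s * s ^ 0"
        by (cases "s \<in> {0<..<1}") (auto intro!: mult_left_mono power_le_one beta_weight_nonneg simp: beta_weight_def)
    qed
    then show ?thesis unfolding bw(2) by simp
  qed
  have swap: "(\<lambda>n. integral\<^sup>L lborel (?f n)) sums (LINT s|lborel. (\<Sum>n. ?f n s))"
  proof (rule sums_integral)
    show "integrable lborel (?f n)" for n by (intro integrable_mult_right bw)
    show "AE s in lborel. summable (\<lambda>n. norm (?f n s))"
    proof (rule AE_I2)
      fix s :: real
      show "summable (\<lambda>n. norm (?f n s))"
      proof (cases "s \<in> {0<..<1}")
        case True
        show ?thesis
        proof (rule summable_comparison_test'[where N = 0])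
          show "summable (\<lambda>n. beta_weight \<alpha> s * (\<bar>r n\<bar> * t ^ n))" by (intro summable_mult abs_r)
          fix n
          have "\<bar>r n\<bar> * t ^ n * (beta_weight \<alpha> s * s ^ n) \<le> \<bar>r n\<bar> * t ^ n * (beta_weight \<alpha> s * 1)"
            using True assms by (intro mult_left_mono power_le_one beta_weight_nonneg) auto
          moreover have "norm (norm (?f n s)) = \<bar>r n\<bar> * t ^ n * (beta_weight \<alpha> s * s ^ n)"
            by (subst norm_f[symmetric]) simp
          ultimately show "norm (norm (?f n s)) \<le> beta_weight \<alpha> s * (\<bar>r n\<bar> * t ^ n)"
            by (simp only: mult_1_right mult_ac)
        qed
      qed (simp add: beta_weight_def)
    qed
    show "summable (\<lambda>n. LINT s|lborel. norm (?f n s))"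
    proof (rule summable_comparison_test'[where N = 0])
      show "summable (\<lambda>n. \<bar>r n\<bar> * t ^ n * Beta (1 - \<alpha>) \<alpha>)" by (intro summable_mult2 abs_r)
      fix n
      have "(LINT s|lborel. norm (?f n s)) = \<bar>r n\<bar> * t ^ n * Beta (real n + 1 - \<alpha>) \<alpha>"
        unfolding norm_f by (subst integral_mult_right_zero) (simp only: bw(2))
      moreover have "\<bar>r n\<bar> * t ^ n * Beta (real n + 1 - \<alpha>) \<alpha> \<le> \<bar>r n\<bar> * t ^ n * Beta (1 - \<alpha>) \<alpha>"
        using assms by (intro mult_left_mono beta_le) auto
      moreover have "0 \<le> \<bar>r n\<bar> * t ^ n * Beta (real n + 1 - \<alpha>) \<alpha>"
        using assms beta_weight_moment(2)[OF assms(1,2), of n] by (intro mult_nonneg_nonneg) auto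
      ultimately show "norm (LINT s|lborel. norm (?f n s)) \<le> \<bar>r n\<bar> * t ^ n * Beta (1 - \<alpha>) \<alpha>"
        by simp
    qed
  qed
  have "(\<lambda>s. \<Sum>n. ?f n s) = (\<lambda>s. beta_weight \<alpha> s * todd_powr \<alpha> (- (t * s)))"
    by (intro ext sums_unique[symmetric] sums_f)
  then have J: "(LINT s|lborel. (\<Sum>n. ?f n s)) = J_ext \<alpha> t"
    using assms by (simp only: J_ext_def max.absorb2)
  have term_integral: "integral\<^sup>L lborel (?f n) = (-1) ^ n * r n * Beta (real n + 1 - \<alpha>) \<alpha> * t ^ n" for n
  proof -
    have "integral\<^sup>L lborel (?f n) = r n * (- t) ^ n * Beta (real n + 1 - \<alpha>) \<alpha>"
      by (subst integral_mult_right_zero) (simp only: bw(2))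
    then show ?thesis by (simp only: power_minus[of t n] mult_ac)
  qed
  show ?thesis using swap unfolding term_integral J .
qed

text \<open>The n-th derivative of a power series tends to \<open>fact n * a n\<close> at 0, and a weak
  inequality survives the limit. In this way complete monotonicity on the open half-axis reaches the
  Taylor coefficients at the boundary point.\<close>

lemma power_series_derivative_signs:
  fixes a :: "nat \<Rightarrow> real"
  assumes "0 < R"
    and f: "\<And>t. 0 \<le> t \<Longrightarrow> t < R \<Longrightarrow> (\<lambda>n. a n * t ^ n) sums f t"
    and sign: "\<And>x. 0 < x \<Longrightarrow> 0 \<le> (-1) ^ n * (deriv ^^ n) f x"
  shows "0 \<le> (-1) ^ n * a n"
proof -
  define F where "F = Abs_fps a"
  have radius: "fps_conv_radius F \<ge> ereal R"
    unfolding F_def fps_conv_radius_def fps_nth_Abs_fps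
  proof (rule conv_radius_geI_ex')
    fix t :: real assume "0 < t" "ereal t < ereal R"
    then show "summable (\<lambda>n. a n * of_real t ^ n)" using f[of t] by (auto intro: sums_summable)
  qed
  have radius': "fps_conv_radius ((fps_deriv ^^ k) F) \<ge> ereal R" for k
    by (induction k) (use radius fps_conv_radius_deriv order_trans in \<open>auto\<close>)
  have inR: "ereal (norm x) < fps_conv_radius ((fps_deriv ^^ k) F)" if "\<bar>x\<bar> < R" for x k
    by (rule less_le_trans[OF _ radius'[of k]]) (use that in simp)
  have fF: "f t = eval_fps F t" if "0 \<le> t" "t < R" for t
    using f[OF that] by (simp add: eval_fps_def F_def sums_iff)
  have D: "(deriv ^^ n) f x = eval_fps ((fps_deriv ^^ n) F) x" if "x \<in> {0<..<R}" for x
    by (rule higher_deriv_eqI(1)[where g = "\<lambda>k. eval_fps ((fps_deriv ^^ k) F)", OF open_greaterThanLessThan _ _ that])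
       (use fF has_field_derivative_eval_fps[OF inR] in auto)
  have "((\<lambda>x. (-1) ^ n * eval_fps ((fps_deriv ^^ n) F) x) \<longlongrightarrow> (-1) ^ n * eval_fps ((fps_deriv ^^ n) F) 0) (at_right 0)"
  proof (intro tendsto_intros)
    have "isCont (eval_fps ((fps_deriv ^^ n) F)) 0"
      using has_field_derivative_eval_fps[OF inR, of 0 n] \<open>0 < R\<close> by (intro DERIV_isCont) auto
    then show "(eval_fps ((fps_deriv ^^ n) F) \<longlongrightarrow> eval_fps ((fps_deriv ^^ n) F) 0) (at_right 0)"
      by (simp add: isCont_def filterlim_at_split)
  qed
  moreover have "eventually (\<lambda>x. 0 \<le> (-1) ^ n * eval_fps ((fps_deriv ^^ n) F) x) (at_right 0)"
    using eventually_at_right_real[OF \<open>0 < R\<close>]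
  proof eventually_elim
    case (elim x)
    then show ?case using sign[of x] D[of x] by simp
  qed
  ultimately have "0 \<le> (-1) ^ n * eval_fps ((fps_deriv ^^ n) F) 0"
    by (rule tendsto_lowerbound) simp
  also have "(-1) ^ n * eval_fps ((fps_deriv ^^ n) F) 0 = fact n * ((-1) ^ n * a n)"
    by (simp add: eval_fps_at_0 fps_0th_higher_deriv F_def)
  finally show ?thesis
    by (rule mult_left_le_imp_le[of "fact n" 0, unfolded mult_zero_right]) simp
qed

text \<open>A completely monotone density m would make J completely monotone, because
  \<open>J' = - m / c\<close> and J is nonnegative. The signs \<open>(-1) ^ n\<close> of the Taylor
  coefficients of J at 0 would then force all Taylor coefficients of the Todd power to be
  nonnegative.\<close>

lemma not_has_cm_density:
  assumes "0 < \<alpha>" "\<alpha> < 1" "0 < c"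
    and fin: "finite_measure \<nu>"
    and meas: "\<And>s. 0 < s \<Longrightarrow> measure \<nu> {0<..s} = c * (J_ext \<alpha> 0 - J_ext \<alpha> s)"
  shows "\<not> has_cm_density \<nu>"
proof
  assume "has_cm_density \<nu>"
  then obtain m where cm: "completely_monotone m"
    and dens: "\<nu> = density (restrict_space lborel {0<..}) (\<lambda>t. ennreal (m t))"
    by (auto simp: has_cm_density_def)
  have m_diff: "(deriv ^^ n) m differentiable (at x)" if "0 < x" for n x
    using cm that by (auto simp: completely_monotone_def smooth_on_pos_def)
  have m_sign: "(-1) ^ n * (deriv ^^ n) m x \<ge> 0" if "0 < x" for n x
    using cm that by (auto simp: completely_monotone_def)
  have m_cont: "continuous_on {0<..} m"
    using m_diff[of _ 0]
    by (intro continuous_at_imp_continuous_on ballI differentiable_imp_continuous_within) auto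
  have J': "(J_ext \<alpha> has_field_derivative - (m x / c)) (at x)" if "0 < x" for x
    by (rule J_ext_deriv_of_density[OF assms(1-3) fin meas m_cont _ dens that]) (use m_sign[of _ 0] in auto)
  \<comment> \<open>The iterated derivatives of J, expressed through those of m.\<close>
  define g where "g n = (if n = 0 then J_ext \<alpha> else (\<lambda>x. - ((deriv ^^ (n - 1)) m x / c)))" for n
  have g_deriv: "(g n has_field_derivative g (Suc n) x) (at x)" if "x \<in> {0<..}" for n x
  proof (cases n)
    case (Suc k)
    have "((deriv ^^ k) m has_field_derivative (deriv ^^ Suc k) m x) (at x)"
      using m_diff[of x k] that by (simp add: DERIV_deriv_iff_real_differentiable)
    then show ?thesis unfolding g_def Suc using \<open>0 < c\<close> by (auto intro!: derivative_eq_intros)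
  qed (use J' that in \<open>simp add: g_def\<close>)
  have J_sign: "0 \<le> (-1) ^ n * (deriv ^^ n) (J_ext \<alpha>) x" if "0 < x" for n x
  proof -
    have "(deriv ^^ n) (J_ext \<alpha>) x = g n x"
      by (rule higher_deriv_eqI(1)[where S = "{0<..}" and g = g]) (use that g_deriv in \<open>auto simp: g_def[of 0]\<close>)
    moreover have "0 \<le> (-1) ^ n * g n x"
    proof (cases n)
      case 0
      then show ?thesis by (simp add: g_def J_ext_nonneg)
    next
      case (Suc k)
      then have "(-1) ^ n * g n x = (-1) ^ k * (deriv ^^ k) m x / c" by (simp add: g_def)
      then show ?thesis using m_sign[OF that, of k] \<open>0 < c\<close> by simp
    qed
    ultimately show ?thesis by simp
  qed
  obtain r where r: "\<And>x. \<bar>x\<bar> < 2 * pi \<Longrightarrow> (\<lambda>n. r n * x ^ n) sums todd_powr \<alpha> x"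
    and neg: "\<exists>n. r n < 0"
    by (rule todd_powr_series_has_negative_coeff[OF assms(1)], rule that; assumption)
  then obtain n where n: "r n < 0" by blast
  have "0 \<le> (-1) ^ n * ((-1) ^ n * r n * Beta (real n + 1 - \<alpha>) \<alpha>)"
    by (rule power_series_derivative_signs[where R = "2 * pi", OF _ J_ext_power_series[OF assms(1,2) _ _ r] J_sign]) auto
  also have "\<dots> = ((-1) ^ n * (-1) ^ n) * (r n * Beta (real n + 1 - \<alpha>) \<alpha>)"
    by (simp only: mult_ac)
  also have "(-1) ^ n * (-1) ^ n = (1::real)" by (simp add: power_mult_distrib[symmetric])
  finally show False
    using n beta_weight_moment(2)[OF assms(1,2), of n] by (simp add: zero_le_mult_iff)
qed

theorem theorem3p4:
  fixes \<alpha> :: real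
  assumes "0 < \<alpha>" and "\<alpha> < 1"
  shows "bernstein_function (F_alpha \<alpha>) \<and>
    \<not> complete_bernstein_function (F_alpha \<alpha>) \<and>
    finite_measure (mu_alpha \<alpha>) \<and>
    (\<forall>s t. 0 < s \<and> s < t \<longrightarrow>
       measure (mu_alpha \<alpha>) {s<..t} = J_alpha \<alpha> s - J_alpha \<alpha> t) \<and>
    (\<forall>x>0. F_alpha \<alpha> x =
       1 / (Gamma \<alpha> * Gamma (1 - \<alpha>)) * (LINT t|mu_alpha \<alpha>. 1 - exp (- x * t))) \<and>
    levy_triple (F_alpha \<alpha>) 0 0 (levy_measure_F_alpha \<alpha>) \<and>
    \<not> has_cm_density (levy_measure_F_alpha \<alpha>)"
proof -
  define c where "c = 1 / (Gamma \<alpha> * Gamma (1 - \<alpha>))"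
  have G: "Gamma \<alpha> > 0" "Gamma (1 - \<alpha>) > 0" using assms by (auto intro: Gamma_real_pos)
  then have c: "c > 0" by (simp add: c_def)
  have fin: "finite_measure (mu_alpha \<alpha>)" by (rule finite_measure_mu_alpha) fact+
  have measure_Ioc: "measure (mu_alpha \<alpha>) {s<..t} = J_ext \<alpha> s - J_ext \<alpha> t" if "0 \<le> s" "s \<le> t" for s t
    using emeasure_mu_alpha_Ioc[OF assms that] J_ext_antimono[OF assms that(2)] by (simp add: measure_def)
  have rep: "F_alpha \<alpha> x = c * (LINT t|mu_alpha \<alpha>. 1 - exp (- x * t))" if "0 < x" for x
    using F_alpha_representation[OF that assms] G by (simp add: c_def)
  have bern: "bernstein_function (F_alpha \<alpha>)"
    by (rule bernstein_function_of_representation[OF fin _ id_measurable_on_pos[OF sets_mu_alpha] _ rep]) (use c in auto)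
  let ?\<nu> = "levy_measure_F_alpha \<alpha>"
  have \<nu>: "?\<nu> = scale_measure (ennreal c) (mu_alpha \<alpha>)" by (simp add: levy_measure_F_alpha_def c_def)
  have sets: "sets ?\<nu> = sets (restrict_space borel {0<..})" by (simp add: \<nu> sets_mu_alpha)
  have fin\<nu>: "finite_measure ?\<nu>"
    using finite_measure.emeasure_finite[OF fin, of "{0<..}"]
    by (intro finite_measureI) (simp add: \<nu> space_scale_measure ennreal_mult_eq_top_iff)
  have levy: "levy_triple (F_alpha \<alpha>) 0 0 ?\<nu>"
    unfolding levy_triple_def
  proof (intro conjI allI impI)
    interpret finite_measure ?\<nu> by fact
    have "(\<integral>\<^sup>+t. ennreal (min 1 t) \<partial>?\<nu>) \<le> (\<integral>\<^sup>+t. 1 \<partial>?\<nu>)"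
      by (intro nn_integral_mono) simp
    also have "\<dots> < \<infinity>" by (simp add: less_top[symmetric])
    finally show "(\<integral>\<^sup>+t. ennreal (min 1 t) \<partial>?\<nu>) < \<infinity>" .
    fix x :: real assume x: "0 < x"
    have "has_bochner_integral ?\<nu> (\<lambda>t. 1 - exp (- x * t)) (F_alpha \<alpha> x)"
    proof (rule has_bochner_integral_nn_integral)
      show "(\<lambda>t. 1 - exp (- x * t)) \<in> borel_measurable ?\<nu>" by (rule one_minus_exp_measurable[OF sets])
      show "AE t in ?\<nu>. 0 \<le> 1 - exp (- x * t)"
        using x by (intro AE_I2) (simp add: space_on_pos[OF sets])
      show "0 \<le> F_alpha \<alpha> x" using F_alpha_nonneg[OF x assms(1)] .
      have "(\<integral>\<^sup>+t. ennreal (1 - exp (- x * t)) \<partial>?\<nu>) = ennreal c * ennreal (Gamma \<alpha> * Gamma (1 - \<alpha>) * F_alpha \<alpha> x)"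
        unfolding \<nu> nn_integral_mu_alpha[OF x assms, symmetric]
        by (intro nn_integral_scale_measure measurable_compose[OF one_minus_exp_measurable[OF sets_mu_alpha] measurable_ennreal])
      also have "\<dots> = ennreal (F_alpha \<alpha> x)"
        using G c F_alpha_nonneg[OF x assms(1)] by (simp add: ennreal_mult'[symmetric] c_def)
      finally show "(\<integral>\<^sup>+t. ennreal (1 - exp (- x * t)) \<partial>?\<nu>) = ennreal (F_alpha \<alpha> x)" .
    qed
    then show "F_alpha \<alpha> x = 0 + 0 * x + (LINT t|?\<nu>. 1 - exp (- x * t))"
      by (simp add: has_bochner_integral_iff)
  qed (use sets in auto)
  have measure\<nu>: "measure ?\<nu> {0<..s} = c * (J_ext \<alpha> 0 - J_ext \<alpha> s)" if "0 < s" for s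
    using c measure_Ioc[of 0 s] that by (simp add: \<nu> measure_scale_measure[of c])
  have "\<not> complete_bernstein_function (F_alpha \<alpha>)"
  proof
    assume "complete_bernstein_function (F_alpha \<alpha>)"
    then obtain a b \<nu>' where \<nu>': "levy_triple (F_alpha \<alpha>) a b \<nu>'" "has_cm_density \<nu>'"
      by (auto simp: complete_bernstein_function_def)
    note unique = bounded_levy_triple_unique[OF \<nu>'(1) levy fin\<nu>]
    have "\<not> has_cm_density \<nu>'"
      by (rule not_has_cm_density[OF assms c]) (use unique measure\<nu> in auto)
    then show False using \<nu>'(2) by blast
  qed
  moreover have "\<not> has_cm_density ?\<nu>"
    by (rule not_has_cm_density[OF assms c fin\<nu> measure\<nu>])
  moreover have "measure (mu_alpha \<alpha>) {s<..t} = J_alpha \<alpha> s - J_alpha \<alpha> t" if "0 < s" "s < t" for s t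
    using measure_Ioc[of s t] that by (simp add: J_alpha_rescaled(2)[OF assms])
  ultimately show ?thesis
    using bern fin rep levy by (simp add: c_def)
qed

end
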